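(* The following is a complete list of the Levi decomposable real Lie subalgebras of $\mathfrak{sl}_3(\mathbb{R})$ up to conjugation in $\mathrm{SL}_3(\mathbb{R})$, where $\mathfrak{s}=\langle X_{\alpha+\beta},\,Y_{\alpha+\beta},\,H_\alpha+H_\beta\rangle$ and the sums are direct sums of vector spaces with the second summand an ideal: (1) (dimension 4) $\mathfrak{u}_{4,9}=\mathfrak{s}\oplus\langle H_\alpha-H_\beta\rangle$ (a direct sum of Lie algebras); (2) (dimension 5) $\mathfrak{u}_{5,2}=\mathfrak{s}+\langle X_\alpha,\,Y_\beta\rangle$; (3) (dimension 5) $\mathfrak{u}_{5,3}=\mathfrak{s}+\langle X_\beta,\,Y_\alpha\rangle$; (4) (dimension 6) $\mathfrak{u}_{6,1}=\mathfrak{s}+\langle X_\alpha,\,Y_\beta,\,H_\alpha-H_\beta\rangle$; (5) (dimension 6) $\mathfrak{u}_{6,2}=\mathfrak{s}+\langle X_\beta,\,Y_\alpha,\,H_\alpha-H_\beta\rangle$. That is, every Levi decomposable real subalgebra of $\mathfrak{sl}_3(\mathbb{R})$ is conjugate under $\mathrm{SL}_3(\mathbb{R})$ to one of these five, and these five are pairwise non-conjugate under $\mathrm{SL}_3(\mathbb{R})$.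
   Context: $\mathfrak{sl}_3(\mathbb{R})$ is the Lie algebra of traceless real $3\times3$ matrices and $\mathrm{SL}_3(\mathbb{R})$ acts on its subalgebras by $g\cdot\mathfrak{u}=g\mathfrak{u}g^{-1}$; conjugate means lying in the same orbit of this action. With $E_{ij}$ the matrix units, the basis of $\mathfrak{sl}_3(\mathbb{R})$ used is $H_\alpha=E_{11}-E_{22}$, $H_\beta=E_{22}-E_{33}$, $X_\alpha=E_{12}$, $X_\beta=E_{23}$, $X_{\alpha+\beta}=-E_{13}$, $Y_\alpha=E_{21}$, $Y_\beta=E_{32}$, $Y_{\alpha+\beta}=-E_{31}$. $\langle\cdots\rangle$ denotes the real linear span. A Lie algebra is called Levi decomposable here if it is neither solvable nor semisimple, i.e. both its Levi factor and its solvable radical are nonzero. *)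

theory Defs
  imports "HOL-Analysis.Analysis"
begin

section \<open>Lie algebras of real matrices\<close>

definition lie_bracket :: "real^'n^'n \<Rightarrow> real^'n^'n \<Rightarrow> real^'n^'n" where
  "lie_bracket A B = A ** B - B ** A"

definition lie_subalgebra :: "(real^'n^'n) set \<Rightarrow> bool" where
  "lie_subalgebra U \<longleftrightarrow> subspace U \<and> (\<forall>A\<in>U. \<forall>B\<in>U. lie_bracket A B \<in> U)"

definition lie_ideal :: "(real^'n^'n) set \<Rightarrow> (real^'n^'n) set \<Rightarrow> bool" where
  "lie_ideal I U \<longleftrightarrow> subspace I \<and> I \<subseteq> U \<and> (\<forall>A\<in>U. \<forall>B\<in>I. lie_bracket A B \<in> I)"

definition derived_algebra :: "(real^'n^'n) set \<Rightarrow> (real^'n^'n) set" where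
  "derived_algebra U = span {lie_bracket A B | A B. A \<in> U \<and> B \<in> U}"

definition lie_solvable :: "(real^'n^'n) set \<Rightarrow> bool" where
  "lie_solvable U \<longleftrightarrow> (\<exists>k. (derived_algebra ^^ k) U = {0})"

text \<open>The span of the union of all solvable ideals is their sum, the largest solvable ideal.\<close>

definition solvable_radical :: "(real^'n^'n) set \<Rightarrow> (real^'n^'n) set" where
  "solvable_radical U = span (\<Union>{I. lie_ideal I U \<and> lie_solvable I})"

definition lie_semisimple :: "(real^'n^'n) set \<Rightarrow> bool" where
  "lie_semisimple U \<longleftrightarrow> solvable_radical U = {0}"

definition levi_decomposable :: "(real^'n^'n) set \<Rightarrow> bool" where
  "levi_decomposable U \<longleftrightarrow> \<not> lie_solvable U \<and> \<not> lie_semisimple U"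

definition sl :: "(real^'n^'n) set" where
  "sl = {A. trace A = 0}"

definition SL :: "(real^'n^'n) set" where
  "SL = {g. det g = 1}"

definition SL_conjugate :: "(real^'n^'n) set \<Rightarrow> (real^'n^'n) set \<Rightarrow> bool" where
  "SL_conjugate U V \<longleftrightarrow> (\<exists>g\<in>SL. V = (\<lambda>A. g ** A ** matrix_inv g) ` U)"

text \<open>Internal direct sum of vector spaces, \<open>U = S \<oplus> I\<close>, whose second summand is an ideal of
  \<open>U\<close>; here \<open>S + I\<close> is the elementwise sum of sets.\<close>

definition direct_sum_with_ideal ::
    "(real^'n^'n) set \<Rightarrow> (real^'n^'n) set \<Rightarrow> (real^'n^'n) set \<Rightarrow> bool" where
  "direct_sum_with_ideal U S I \<longleftrightarrow>
     subspace S \<and> subspace I \<and> U = S + I \<and> S \<inter> I = {0} \<and> lie_ideal I U"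

text \<open>The sum is one of Lie algebras when both summands are ideals.\<close>

definition lie_direct_sum ::
    "(real^'n^'n) set \<Rightarrow> (real^'n^'n) set \<Rightarrow> (real^'n^'n) set \<Rightarrow> bool" where
  "lie_direct_sum U S I \<longleftrightarrow> direct_sum_with_ideal U S I \<and> lie_ideal S U"

section \<open>The basis of \<open>sl\<^sub>3(\<real>)\<close> and the five subalgebras\<close>

text \<open>The indices are the three elements \<open>1\<close>, \<open>2\<close>, \<open>3\<close> of the type \<open>3\<close> (in which \<open>3 = 0\<close>).\<close>

definition matrix_unit :: "3 \<Rightarrow> 3 \<Rightarrow> real^3^3" where
  "matrix_unit i j = (\<chi> a b. if a = i \<and> b = j then 1 else 0)"

definition H_\<alpha> :: "real^3^3" where "H_\<alpha> = matrix_unit 1 1 - matrix_unit 2 2"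
definition H_\<beta> :: "real^3^3" where "H_\<beta> = matrix_unit 2 2 - matrix_unit 3 3"
definition X_\<alpha> :: "real^3^3" where "X_\<alpha> = matrix_unit 1 2"
definition X_\<beta> :: "real^3^3" where "X_\<beta> = matrix_unit 2 3"
definition X_\<alpha>\<beta> :: "real^3^3" where "X_\<alpha>\<beta> = - matrix_unit 1 3"
definition Y_\<alpha> :: "real^3^3" where "Y_\<alpha> = matrix_unit 2 1"
definition Y_\<beta> :: "real^3^3" where "Y_\<beta> = matrix_unit 3 2"
definition Y_\<alpha>\<beta> :: "real^3^3" where "Y_\<alpha>\<beta> = - matrix_unit 3 1"

definition \<ss> :: "(real^3^3) set" where
  "\<ss> = span {X_\<alpha>\<beta>, Y_\<alpha>\<beta>, H_\<alpha> + H_\<beta>}"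

definition u_4_9 :: "(real^3^3) set" where "u_4_9 = \<ss> + span {H_\<alpha> - H_\<beta>}"
definition u_5_2 :: "(real^3^3) set" where "u_5_2 = \<ss> + span {X_\<alpha>, Y_\<beta>}"
definition u_5_3 :: "(real^3^3) set" where "u_5_3 = \<ss> + span {X_\<beta>, Y_\<alpha>}"
definition u_6_1 :: "(real^3^3) set" where "u_6_1 = \<ss> + span {X_\<alpha>, Y_\<beta>, H_\<alpha> - H_\<beta>}"
definition u_6_2 :: "(real^3^3) set" where "u_6_2 = \<ss> + span {X_\<beta>, Y_\<alpha>, H_\<alpha> - H_\<beta>}"

definition levi_list :: "(real^3^3) set list" where
  "levi_list = [u_4_9, u_5_2, u_5_3, u_6_1, u_6_2]"

end

theory Submission
  imports Defs
begin

text \<open>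
  The last nonzero derived term of a solvable ideal of \<open>U\<close> is an abelian ideal \<open>\<A>\<close>. A traceless
  commuting family in dimension \<open>3\<close> has a common real eigenvector, and its weight space \<open>W\<close> is proper
  and nonzero. For \<open>X \<in> \<A>\<close> and \<open>M \<in> U\<close> the matrix \<open>[X, M]\<close> commutes with \<open>X\<close> and is therefore nilpotent,
  so \<open>W\<close> is invariant under \<open>U\<close>. Hence \<open>U\<close> stabilizes a line or a plane, and after transposing
  in the second case and conjugating by a rotation, \<open>U\<close> lies in the stabilizer \<open>u_6_2\<close> of the line
  through the second basis vector.

  The projection of \<open>U\<close> to the Levi factor \<open>u_4_9 \<cong> gl\<^sub>2\<close> of \<open>u_6_2\<close> contains \<open>\<ss> \<cong> sl\<^sub>2\<close>, because a Lie algebra of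
  dimension at most \<open>2\<close> is solvable. The kernel of the projection is a submodule of the irreducible
  \<open>\<ss>\<close>-module \<open>\<langle>X_\<beta>, Y_\<alpha>\<rangle>\<close>. If it is everything, \<open>U\<close> is \<open>u_5_3\<close> or \<open>u_6_2\<close>. If it is zero, the image
  is not \<open>\<ss>\<close>, since \<open>\<ss>\<close> has no nonzero abelian ideal; so \<open>U\<close> contains some \<open>H_\<alpha> - H_\<beta> + N\<close> with
  \<open>N \<in> \<langle>X_\<beta>, Y_\<alpha>\<rangle>\<close>. Conjugating \<open>N\<close> away yields \<open>u_4_9\<close>.
\<close>

section \<open>The derived series\<close>

lemma scaleR_matrix_mult_left: "(c *\<^sub>R A) ** B = c *\<^sub>R (A ** B)"
  for A :: "real^'n^'m" and B :: "real^'k^'n"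
  by (simp add: matrix_matrix_mult_def vec_eq_iff sum_distrib_left mult.assoc)

lemma scaleR_matrix_mult_right: "A ** (c *\<^sub>R B) = c *\<^sub>R (A ** B)"
  for A :: "real^'n^'m" and B :: "real^'k^'n"
  by (simp add: matrix_matrix_mult_def vec_eq_iff sum_distrib_left algebra_simps)

lemma matrix_mult_diff_left: "(A - B) ** C = A ** C - B ** C"
  for A :: "real^'n^'m" and C :: "real^'k^'n"
  by (simp add: matrix_matrix_mult_def vec_eq_iff sum_subtractf algebra_simps)

lemma matrix_mult_diff_right: "C ** (A - B) = C ** A - C ** B"
  for A :: "real^'n^'m" and C :: "real^'m^'k"
  by (simp add: matrix_matrix_mult_def vec_eq_iff sum_subtractf algebra_simps)

lemma matrix_mult_add_left: "(A + B) ** C = A ** C + B ** C"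
  for A :: "real^'n^'m" and C :: "real^'k^'n"
  by (simp add: matrix_matrix_mult_def vec_eq_iff sum.distrib algebra_simps)

lemmas matrix_mult_linear_simps = scaleR_matrix_mult_left scaleR_matrix_mult_right
  matrix_mult_diff_left matrix_mult_diff_right matrix_add_ldistrib matrix_mult_add_left

lemma bilinear_lie_bracket: "bilinear (lie_bracket :: real^'n^'n \<Rightarrow> _)"
  unfolding bilinear_def lie_bracket_def
  by (auto intro!: linearI simp: matrix_mult_linear_simps algebra_simps)

lemmas lie_bracket_linear_simps =
  bilinear_ladd[OF bilinear_lie_bracket] bilinear_radd[OF bilinear_lie_bracket]
  bilinear_lmul[OF bilinear_lie_bracket] bilinear_rmul[OF bilinear_lie_bracket]
  bilinear_lzero[OF bilinear_lie_bracket] bilinear_rzero[OF bilinear_lie_bracket]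

lemma lie_bracket_self [simp]: "lie_bracket A A = 0"
  by (simp add: lie_bracket_def)

lemma lie_bracket_swap: "lie_bracket A B = - lie_bracket B A"
  by (simp add: lie_bracket_def)

lemma lie_bracket_jacobi:
  "lie_bracket A (lie_bracket B C) = lie_bracket (lie_bracket A B) C + lie_bracket B (lie_bracket A C)"
  by (simp add: lie_bracket_def matrix_mult_linear_simps matrix_mul_assoc algebra_simps)

lemma subspace_derived_algebra: "subspace (derived_algebra U)"
  by (simp add: derived_algebra_def)

lemma lie_bracket_in_derived_algebra:
  "A \<in> U \<Longrightarrow> B \<in> U \<Longrightarrow> lie_bracket A B \<in> derived_algebra U"
  unfolding derived_algebra_def by (auto intro: span_base)

lemma derived_algebra_minimal:
  assumes "subspace V" "\<And>A B. A \<in> U \<Longrightarrow> B \<in> U \<Longrightarrow> lie_bracket A B \<in> V"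
  shows "derived_algebra U \<subseteq> V"
  unfolding derived_algebra_def by (rule span_minimal) (use assms in auto)

lemma derived_algebra_mono: "U \<subseteq> V \<Longrightarrow> derived_algebra U \<subseteq> derived_algebra V"
  by (meson derived_algebra_minimal lie_bracket_in_derived_algebra subset_iff subspace_derived_algebra)

lemma derived_algebra_subset: "lie_subalgebra U \<Longrightarrow> derived_algebra U \<subseteq> U"
  by (simp add: lie_subalgebra_def derived_algebra_minimal)

lemma lie_subalgebra_derived_algebra:
  assumes "lie_subalgebra U"
  shows "lie_subalgebra (derived_algebra U)"
  unfolding lie_subalgebra_def
  using derived_algebra_subset[OF assms] subspace_derived_algebra
  by (auto intro: lie_bracket_in_derived_algebra)

lemma derived_series_subset:
  assumes "lie_subalgebra U"
  shows "lie_subalgebra ((derived_algebra ^^ k) U)" "(derived_algebra ^^ k) U \<subseteq> U"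
proof -
  have "lie_subalgebra ((derived_algebra ^^ k) U) \<and> (derived_algebra ^^ k) U \<subseteq> U"
    by (induction k) (use assms in \<open>auto dest: derived_algebra_subset lie_subalgebra_derived_algebra\<close>)
  then show "lie_subalgebra ((derived_algebra ^^ k) U)" "(derived_algebra ^^ k) U \<subseteq> U"
    by auto
qed

text \<open>The factor is \<open>c = 1\<close> for conjugation and \<open>block_part\<close>, and
  \<open>c = -1\<close> for transposition, which reverses brackets. The bracket rule is asked on
  \<open>U\<close> only, because \<open>block_part\<close> obeys it on \<open>u_6_2\<close> but not
  on all matrices.\<close>

lemma derived_algebra_image:
  assumes "linear \<phi>" "c \<noteq> 0"
    and "\<And>A B. A \<in> U \<Longrightarrow> B \<in> U \<Longrightarrow> \<phi> (lie_bracket A B) = c *\<^sub>R lie_bracket (\<phi> A) (\<phi> B)"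
  shows "derived_algebra (\<phi> ` U) = \<phi> ` derived_algebra U"
proof
  have "lie_bracket (\<phi> A) (\<phi> B) = \<phi> (inverse c *\<^sub>R lie_bracket A B)" if "A \<in> U" "B \<in> U" for A B
    using that assms by (simp add: linear_scale)
  then show "derived_algebra (\<phi> ` U) \<subseteq> \<phi> ` derived_algebra U"
    by (intro derived_algebra_minimal linear_subspace_image[OF assms(1)] subspace_derived_algebra)
       (auto intro!: imageI subspace_scale[OF subspace_derived_algebra] lie_bracket_in_derived_algebra)
  show "\<phi> ` derived_algebra U \<subseteq> derived_algebra (\<phi> ` U)"
    unfolding image_subset_iff_subset_vimage
    by (intro derived_algebra_minimal linear_subspace_vimage[OF assms(1)] subspace_derived_algebra)
       (simp add: assms(3) subspace_scale[OF subspace_derived_algebra] lie_bracket_in_derived_algebra)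
qed

lemma lie_subalgebra_image:
  assumes "linear \<phi>" "c \<noteq> 0" "lie_subalgebra U"
    and "\<And>A B. A \<in> U \<Longrightarrow> B \<in> U \<Longrightarrow> \<phi> (lie_bracket A B) = c *\<^sub>R lie_bracket (\<phi> A) (\<phi> B)"
  shows "lie_subalgebra (\<phi> ` U)"
proof -
  have "lie_bracket (\<phi> A) (\<phi> B) = \<phi> (inverse c *\<^sub>R lie_bracket A B)" if "A \<in> U" "B \<in> U" for A B
    using that assms by (simp add: linear_scale)
  then show ?thesis
    using assms unfolding lie_subalgebra_def
    by (auto intro!: linear_subspace_image imageI subspace_scale)
qed

lemma derived_series_image:
  assumes "linear \<phi>" "c \<noteq> 0" "lie_subalgebra U"
    and "\<And>A B. A \<in> U \<Longrightarrow> B \<in> U \<Longrightarrow> \<phi> (lie_bracket A B) = c *\<^sub>R lie_bracket (\<phi> A) (\<phi> B)"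
  shows "(derived_algebra ^^ k) (\<phi> ` U) = \<phi> ` (derived_algebra ^^ k) U"
proof (induction k)
  case (Suc k)
  have "derived_algebra (\<phi> ` (derived_algebra ^^ k) U) = \<phi> ` derived_algebra ((derived_algebra ^^ k) U)"
    using derived_series_subset(2)[OF assms(3), of k]
    by (intro derived_algebra_image[OF assms(1,2)] assms(4)) auto
  then show ?case
    using Suc by simp
qed simp

lemma derived_algebra_abelian:
  assumes "\<And>A B. A \<in> U \<Longrightarrow> B \<in> U \<Longrightarrow> lie_bracket A B = 0"
  shows "derived_algebra U = {0}"
  using derived_algebra_minimal[of "{0}" U] assms subspace_0[OF subspace_derived_algebra[of U]]
  by auto

text \<open>By bilinearity and antisymmetry all brackets of combinations of \<open>a\<close> and
  \<open>b\<close> are multiples of \<open>[a, b]\<close>, so the first derived algebra is at most a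
  line, hence abelian.\<close>

lemma derived_algebra_twice_dim_le_2:
  fixes L :: "(real^'n^'n) set"
  assumes "dim L \<le> 2"
  shows "derived_algebra (derived_algebra L) = {0}"
proof -
  obtain B where B: "B \<subseteq> L" "independent B" "L \<subseteq> span B" "card B = dim L"
    using basis_exists by blast
  have "finite B"
    using B(2) independent_imp_finite by blast
  \<comment> \<open>The basis may have fewer than two elements, and \<open>a = b\<close> is allowed;
    enclosing it in \<open>{a, b}\<close> treats all dimensions at once.\<close>
  then obtain a b where ab: "B \<subseteq> {a, b}"
  proof -
    have "card B = 0 \<or> card B = 1 \<or> card B = 2"
      using B(4) assms by linarith
    then show thesis
      using that \<open>finite B\<close> by (metis card_0_eq card_1_singletonE card_2_iff empty_subsetI insert_mono order_refl)
  qed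
  have comb: "\<exists>s t. x = s *\<^sub>R a + t *\<^sub>R b" if "x \<in> L" for x
    using that B(3) span_mono[OF ab] by (fastforce simp: span_insert span_singleton algebra_simps)
  have "lie_bracket x y \<in> span {lie_bracket a b}" if xy: "x \<in> L" "y \<in> L" for x y
  proof -
    obtain s t s' t' where "x = s *\<^sub>R a + t *\<^sub>R b" "y = s' *\<^sub>R a + t' *\<^sub>R b"
      using comb[OF xy(1)] comb[OF xy(2)] by blast
    then have "lie_bracket x y = (s * t' - t * s') *\<^sub>R lie_bracket a b"
      using lie_bracket_swap[of b a]
      by (simp add: lie_bracket_linear_simps algebra_simps)
    then show ?thesis
      by (simp add: span_base span_scale)
  qed
  then have "derived_algebra L \<subseteq> span {lie_bracket a b}"
    by (intro derived_algebra_minimal) auto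
  then have multiple: "\<exists>k. x = k *\<^sub>R lie_bracket a b" if "x \<in> derived_algebra L" for x
    using that by (auto simp: span_singleton)
  have "lie_bracket x y = 0" if "x \<in> derived_algebra L" "y \<in> derived_algebra L" for x y
    using multiple[OF that(1)] multiple[OF that(2)] by (auto simp: lie_bracket_linear_simps)
  then show ?thesis
    by (rule derived_algebra_abelian)
qed

text \<open>A nonzero radical needs a nonzero solvable ideal \<open>I\<close>. By the Jacobi
  identity its derived terms remain ideals of \<open>U\<close>, not merely of \<open>I\<close>, and
  the last nonzero one has zero derived algebra.\<close>

lemma abelian_ideal_exists:
  assumes "\<not> lie_semisimple U"
  obtains A where "lie_ideal A U" "A \<noteq> {0}" "\<And>X Y. X \<in> A \<Longrightarrow> Y \<in> A \<Longrightarrow> lie_bracket X Y = 0"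
proof -
  obtain I where I: "lie_ideal I U" "lie_solvable I" "I \<noteq> {0}"
  proof -
    have "\<not> \<Union>{I. lie_ideal I U \<and> lie_solvable I} \<subseteq> {0}"
    proof
      assume "\<Union>{I. lie_ideal I U \<and> lie_solvable I} \<subseteq> {0}"
      then have "span (\<Union>{I. lie_ideal I U \<and> lie_solvable I}) \<subseteq> {0}"
        by (intro span_minimal) auto
      then show False
        using assms span_0 unfolding lie_semisimple_def solvable_radical_def by blast
    qed
    then show thesis
      using that by blast
  qed
  define D where "D k = (derived_algebra ^^ k) I" for k
  have ideal: "lie_ideal (D k) U" for k
  proof (induction k)
    case (Suc k)
    have D: "D (Suc k) = derived_algebra (D k)"
      by (simp add: D_def)
    have sub: "D (Suc k) \<subseteq> D k"
      unfolding D using Suc by (intro derived_algebra_subset) (auto simp: lie_ideal_def lie_subalgebra_def)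
    have "lie_bracket A B \<in> D (Suc k)" if "A \<in> U" "B \<in> D (Suc k)" for A B
    proof -
      \<comment> \<open>For fixed \<open>A\<close> the condition on \<open>B\<close> is linear, so
        it suffices to verify it on the generating brackets, where the Jacobi identity
        applies.\<close>
      have "D (Suc k) \<subseteq> {B. lie_bracket A B \<in> D (Suc k)}"
        unfolding D
      proof (intro derived_algebra_minimal)
        show "subspace {B. lie_bracket A B \<in> derived_algebra (D k)}"
          using subspace_derived_algebra[of "D k"]
          by (auto simp: subspace_def lie_bracket_linear_simps)
        show "lie_bracket B C \<in> {B. lie_bracket A B \<in> derived_algebra (D k)}"
          if "B \<in> D k" "C \<in> D k" for B C
          using that Suc \<open>A \<in> U\<close> unfolding lie_ideal_def
          by (auto simp: lie_bracket_jacobi[of A] intro!: subspace_add[OF subspace_derived_algebra]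
              lie_bracket_in_derived_algebra)
      qed
      then show ?thesis
        using that by auto
    qed
    then show ?case
      using Suc sub unfolding lie_ideal_def by (auto simp: D subspace_derived_algebra)
  qed (simp add: D_def I)
  obtain k where k: "D k = {0}" "\<And>j. j < k \<Longrightarrow> D j \<noteq> {0}"
    using I(2) unfolding lie_solvable_def D_def[symmetric] by (meson exists_least_iff)
  \<comment> \<open>As \<open>I\<close> is nonzero, the series cannot vanish at index 0, so
    \<open>k\<close> has a predecessor; minimality of \<open>k\<close> makes \<open>D j\<close>
    nonzero.\<close>
  obtain j where j: "k = Suc j"
    using k(1) I(3) by (cases k) (auto simp: D_def)
  show thesis
  proof (rule that[of "D j"])
    show "lie_ideal (D j) U" "D j \<noteq> {0}"
      using ideal k(2) j by auto
    show "lie_bracket X Y = 0" if "X \<in> D j" "Y \<in> D j" for X Y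
      using lie_bracket_in_derived_algebra[OF that] k(1) j by (simp add: D_def)
  qed
qed

section \<open>Conjugation and transposition\<close>

lemma SL_matrix_inv:
  assumes "g \<in> SL"
  shows "g ** matrix_inv g = mat 1" "matrix_inv g ** g = mat 1" "matrix_inv g \<in> SL"
proof -
  have "\<exists>h. g ** h = mat 1 \<and> h ** g = mat 1"
    using assms invertible_det_nz[of g] by (simp add: SL_def invertible_def)
  then have *: "g ** matrix_inv g = mat 1 \<and> matrix_inv g ** g = mat 1"
    unfolding matrix_inv_def by (rule someI_ex)
  then show "g ** matrix_inv g = mat 1" "matrix_inv g ** g = mat 1"
    by auto
  show "matrix_inv g \<in> SL"
    using * assms det_mul[of g "matrix_inv g"] by (simp add: SL_def)
qed

text \<open>\<open>matrix_inv\<close> is a choice of two-sided inverse; for square matrices a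
  one-sided inverse is two-sided and determines it.\<close>

lemma matrix_inv_unique: "g ** h = mat 1 \<Longrightarrow> matrix_inv g = h" for g h :: "real^'n^'n"
  unfolding matrix_inv_def
  by (rule some_equality) (metis matrix_left_right_inverse matrix_mul_assoc matrix_mul_lid matrix_mul_rid)+

definition conj_by :: "real^'n^'n \<Rightarrow> real^'n^'n \<Rightarrow> real^'n^'n" where
  "conj_by g A = g ** A ** matrix_inv g"

lemma SL_conjugate_iff: "SL_conjugate U V \<longleftrightarrow> (\<exists>g\<in>SL. V = conj_by g ` U)"
  by (simp add: SL_conjugate_def conj_by_def[abs_def])

lemma linear_conj_by: "linear (conj_by g)"
  unfolding conj_by_def by (auto intro!: linearI simp: matrix_mult_linear_simps)

lemma conj_by_mult:
  assumes "g \<in> SL"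
  shows "conj_by g (A ** B) = conj_by g A ** conj_by g B"
proof -
  have "conj_by g A ** conj_by g B = g ** A ** (matrix_inv g ** g) ** B ** matrix_inv g"
    by (simp only: conj_by_def matrix_mul_assoc)
  then show ?thesis
    by (simp add: SL_matrix_inv[OF assms] conj_by_def matrix_mul_assoc)
qed

lemma conj_by_lie_bracket:
  "g \<in> SL \<Longrightarrow> conj_by g (lie_bracket A B) = lie_bracket (conj_by g A) (conj_by g B)"
  by (simp add: lie_bracket_def conj_by_mult linear_diff[OF linear_conj_by])

lemma trace_conj_by: "g \<in> SL \<Longrightarrow> trace (conj_by g A) = trace A"
  unfolding conj_by_def by (subst trace_mul_sym) (simp add: matrix_mul_assoc SL_matrix_inv)

lemma conj_by_conj_by:
  assumes "g \<in> SL" "h \<in> SL"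
  shows "conj_by h (conj_by g A) = conj_by (h ** g) A"
proof -
  have "matrix_inv (h ** g) = matrix_inv g ** matrix_inv h"
    by (rule matrix_inv_unique)
       (metis SL_matrix_inv(1) assms matrix_mul_assoc matrix_mul_rid)
  then show ?thesis
    by (simp add: conj_by_def matrix_mul_assoc)
qed

lemma SL_mult: "g \<in> SL \<Longrightarrow> h \<in> SL \<Longrightarrow> g ** h \<in> SL"
  by (simp add: SL_def det_mul)

lemma mat_1_in_SL: "mat 1 \<in> SL"
  by (simp add: SL_def)

lemma conj_by_mat_1 [simp]: "conj_by (mat 1) A = A"
  by (simp add: conj_by_def matrix_inv_unique)

lemma conj_by_inverse:
  assumes "g \<in> SL"
  shows "conj_by (matrix_inv g) (conj_by g A) = A" "conj_by g (conj_by (matrix_inv g) A) = A"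
  by (simp_all add: conj_by_conj_by assms SL_matrix_inv)

lemma inj_conj_by: "g \<in> SL \<Longrightarrow> inj (conj_by g)"
  by (metis conj_by_inverse(1) injI)

lemma SL_conjugate_refl: "SL_conjugate U U"
  unfolding SL_conjugate_iff by (rule bexI[OF _ mat_1_in_SL]) simp

lemma SL_conjugate_sym: "SL_conjugate U V \<Longrightarrow> SL_conjugate V U"
  unfolding SL_conjugate_iff
  by (metis (no_types, lifting) SL_matrix_inv(3) conj_by_inverse(1) image_cong image_ident image_image)

lemma SL_conjugate_trans: "SL_conjugate U V \<Longrightarrow> SL_conjugate V W \<Longrightarrow> SL_conjugate U W"
  unfolding SL_conjugate_iff
  by (metis (no_types, lifting) SL_mult conj_by_conj_by image_cong image_image)

lemma SL_conjugate_dim: "SL_conjugate U V \<Longrightarrow> dim U = dim V"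
  unfolding SL_conjugate_iff
  by (metis dim_image_eq inj_conj_by linear_conj_by inj_on_subset subset_UNIV)

lemma transpose_diff: "transpose (A - B) = transpose A - transpose B" for A B :: "real^'n^'m"
  by (simp add: transpose_def vec_eq_iff)

lemma linear_transpose: "linear (transpose :: real^'n^'m \<Rightarrow> _)"
  by (auto intro!: linearI simp: transpose_def vec_eq_iff)

lemma trace_transpose: "trace (transpose A) = trace A"
  by (simp add: trace_def transpose_def)

lemma transpose_lie_bracket:
  "transpose (lie_bracket A B) = (-1) *\<^sub>R lie_bracket (transpose A) (transpose B)"
  by (simp add: lie_bracket_def transpose_diff matrix_transpose_mul)

lemma transpose_image_transpose_image [simp]:
  "transpose ` transpose ` U = U" for U :: "(real^'n^'m) set"
  by (simp add: image_image)

lemma transpose_conj_by: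
  assumes "g \<in> SL"
  shows "transpose (conj_by g A) = conj_by (transpose (matrix_inv g)) (transpose A)"
proof -
  have "transpose (matrix_inv g) ** transpose g = mat 1"
    by (metis SL_matrix_inv(1) assms matrix_transpose_mul transpose_mat)
  then have "matrix_inv (transpose (matrix_inv g)) = transpose g"
    by (rule matrix_inv_unique)
  then show ?thesis
    by (simp add: conj_by_def matrix_transpose_mul matrix_mul_assoc)
qed

lemma SL_transpose: "g \<in> SL \<Longrightarrow> transpose g \<in> SL"
  by (simp add: SL_def)

lemma SL_conjugate_transpose:
  assumes "SL_conjugate U V"
  shows "SL_conjugate (transpose ` U) (transpose ` V)"
proof -
  obtain g where g: "g \<in> SL" "V = conj_by g ` U"
    using assms SL_conjugate_iff by blast
  then have "transpose ` V = conj_by (transpose (matrix_inv g)) ` transpose ` U"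
    by (simp add: image_image transpose_conj_by)
  then show ?thesis
    unfolding SL_conjugate_iff using SL_transpose SL_matrix_inv(3) g(1) by blast
qed

section \<open>Transport of the hypotheses along conjugation and transposition\<close>

text \<open>Stands in for a nonzero radical: an abelian ideal is carried along by an injective
  linear map respecting brackets up to a factor, with no need to follow the span of all solvable
  ideals.\<close>

definition has_abelian_ideal :: "(real^'n^'n) set \<Rightarrow> bool" where
  "has_abelian_ideal U \<longleftrightarrow>
     (\<exists>A. lie_ideal A U \<and> A \<noteq> {0} \<and> (\<forall>X\<in>A. \<forall>Y\<in>A. lie_bracket X Y = 0))"

lemma has_abelian_ideal_image:
  assumes "linear \<phi>" "inj \<phi>" "c \<noteq> 0" "has_abelian_ideal U"
    and hom: "\<And>A B. \<phi> (lie_bracket A B) = c *\<^sub>R lie_bracket (\<phi> A) (\<phi> B)"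
  shows "has_abelian_ideal (\<phi> ` U)"
proof -
  obtain A where A: "lie_ideal A U" "A \<noteq> {0}" "\<And>X Y. X \<in> A \<Longrightarrow> Y \<in> A \<Longrightarrow> lie_bracket X Y = 0"
    using assms(4) by (auto simp: has_abelian_ideal_def)
  have eq: "lie_bracket (\<phi> X) (\<phi> Y) = \<phi> (inverse c *\<^sub>R lie_bracket X Y)" for X Y
    using assms by (simp add: linear_scale)
  have sub: "subspace A"
    using A by (auto simp: lie_ideal_def)
  show ?thesis
    unfolding has_abelian_ideal_def
  proof (intro exI[of _ "\<phi> ` A"] conjI ballI)
    show "lie_ideal (\<phi> ` A) (\<phi> ` U)"
      using A(1) sub unfolding lie_ideal_def
      by (auto simp: eq intro!: linear_subspace_image assms imageI subspace_scale)
    obtain a where "a \<in> A" "a \<noteq> 0"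
      using A(2) subspace_0[OF sub] by blast
    then show "\<phi> ` A \<noteq> {0}"
      using assms(1,2) by (metis image_eqI linear_injective_0 singletonD)
    show "lie_bracket X Y = 0" if "X \<in> \<phi> ` A" "Y \<in> \<phi> ` A" for X Y
      using that A(3) by (auto simp: eq linear_0[OF assms(1)])
  qed
qed

lemma lie_solvable_image_iff:
  assumes "linear \<phi>" "inj \<phi>" "c \<noteq> 0" "lie_subalgebra U"
    and hom: "\<And>A B. \<phi> (lie_bracket A B) = c *\<^sub>R lie_bracket (\<phi> A) (\<phi> B)"
  shows "lie_solvable (\<phi> ` U) \<longleftrightarrow> lie_solvable U"
proof -
  have "\<phi> ` S = {0} \<longleftrightarrow> S = {0}" for S
    using assms(1,2) linear_0[OF assms(1)] by (metis image_empty image_insert inj_image_eq_iff)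
  then show ?thesis
    unfolding lie_solvable_def by (simp add: derived_series_image[OF assms(1,3,4) hom])
qed

definition levi_candidate :: "(real^'n^'n) set \<Rightarrow> bool" where
  "levi_candidate U \<longleftrightarrow> U \<subseteq> sl \<and> lie_subalgebra U \<and> \<not> lie_solvable U \<and> has_abelian_ideal U"

lemma levi_candidate_image:
  assumes "linear \<phi>" "inj \<phi>" "c \<noteq> 0" "levi_candidate U"
    and "\<And>A B. \<phi> (lie_bracket A B) = c *\<^sub>R lie_bracket (\<phi> A) (\<phi> B)"
    and "\<And>A. trace (\<phi> A) = trace A"
  shows "levi_candidate (\<phi> ` U)"
  using assms lie_subalgebra_image[OF assms(1,3), of U] has_abelian_ideal_image[OF assms(1-3) _ assms(5)]
    lie_solvable_image_iff[OF assms(1-3) _ assms(5), of U]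
  unfolding levi_candidate_def sl_def by auto

lemma levi_candidate_conj_by: "g \<in> SL \<Longrightarrow> levi_candidate U \<Longrightarrow> levi_candidate (conj_by g ` U)"
  by (rule levi_candidate_image[of _ 1])
     (simp_all add: linear_conj_by inj_conj_by conj_by_lie_bracket trace_conj_by)

lemma levi_candidate_transpose: "levi_candidate U \<Longrightarrow> levi_candidate (transpose ` U)"
  by (rule levi_candidate_image[of _ "-1"])
     (simp_all add: linear_transpose transpose_lie_bracket trace_transpose inj_def)

section \<open>The five subalgebras\<close>

lemma matrix_3_eq_iff:
  "A = B \<longleftrightarrow> A$1$1 = B$1$1 \<and> A$1$2 = B$1$2 \<and> A$1$3 = B$1$3 \<and> A$2$1 = B$2$1 \<and> A$2$2 = B$2$2
     \<and> A$2$3 = B$2$3 \<and> A$3$1 = B$3$1 \<and> A$3$2 = B$3$2 \<and> A$3$3 = B$3$3"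
  for A B :: "real^3^3"
  by (auto simp: vec_eq_iff forall_3)

lemma matrix_mult_3_nth: "(A ** B)$i$j = A$i$1 * B$1$j + A$i$2 * B$2$j + A$i$3 * B$3$j"
  for A B :: "real^3^3"
  by (simp add: matrix_matrix_mult_def sum_3)

lemma lie_bracket_3_nth: "lie_bracket A B $i$j =
   A$i$1 * B$1$j + A$i$2 * B$2$j + A$i$3 * B$3$j - (B$i$1 * A$1$j + B$i$2 * A$2$j + B$i$3 * A$3$j)"
  for A B :: "real^3^3"
  by (simp add: lie_bracket_def matrix_mult_3_nth)

lemma trace_3: "trace A = A$1$1 + A$2$2 + A$3$3" for A :: "real^3^3"
  by (simp add: trace_def sum_3)

lemma matrix_unit_nth [simp]: "matrix_unit i j $ a $ b = (if a = i \<and> b = j then 1 else 0)"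
  by (simp add: matrix_unit_def)

lemmas basis_defs = H_\<alpha>_def H_\<beta>_def X_\<alpha>_def X_\<beta>_def X_\<alpha>\<beta>_def Y_\<alpha>_def Y_\<beta>_def Y_\<alpha>\<beta>_def

text \<open>This and the next lemmas trade spans for equations between entries, so that membership,
  brackets and ideals become entrywise computations. Coefficients are read off the entries; those of
  \<open>X_\<alpha>\<beta>\<close> and \<open>Y_\<alpha>\<beta>\<close> get a minus sign from the
  choice of basis.\<close>

lemma \<ss>_eq: "\<ss> = {M. M$1$2 = 0 \<and> M$3$2 = 0 \<and> M$2$1 = 0 \<and> M$2$3 = 0 \<and> M$2$2 = 0 \<and> M$3$3 = - M$1$1}"
    (is "_ = ?R")
proof
  show "\<ss> \<subseteq> ?R"
    unfolding \<ss>_def by (rule span_minimal) (auto simp: basis_defs subspace_def algebra_simps)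
  show "?R \<subseteq> \<ss>"
  proof
    fix M :: "real^3^3"
    assume "M \<in> ?R"
    then have "M = (- M$1$3) *\<^sub>R X_\<alpha>\<beta> + (- M$3$1) *\<^sub>R Y_\<alpha>\<beta> + M$1$1 *\<^sub>R (H_\<alpha> + H_\<beta>)"
      by (simp add: basis_defs matrix_3_eq_iff)
    then show "M \<in> \<ss>"
      unfolding \<ss>_def by (metis insertI1 insertI2 span_add span_base span_scale)
  qed
qed

lemma span_columns_eq: "span {X_\<alpha>, Y_\<beta>} = {M. M$1$1 = 0 \<and> M$1$3 = 0 \<and> M$2$1 = 0 \<and> M$2$2 = 0
   \<and> M$2$3 = 0 \<and> M$3$1 = 0 \<and> M$3$3 = 0}"  (is "_ = ?R")
proof
  show "span {X_\<alpha>, Y_\<beta>} \<subseteq> ?R"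
    by (rule span_minimal) (auto simp: basis_defs subspace_def algebra_simps)
  show "?R \<subseteq> span {X_\<alpha>, Y_\<beta>}"
  proof
    fix M :: "real^3^3"
    assume "M \<in> ?R"
    then have "M = M$1$2 *\<^sub>R X_\<alpha> + M$3$2 *\<^sub>R Y_\<beta>"
      by (simp add: basis_defs matrix_3_eq_iff)
    then show "M \<in> span {X_\<alpha>, Y_\<beta>}"
      by (metis insertI1 insertI2 span_add span_base span_scale)
  qed
qed

lemma span_rows_eq: "span {X_\<beta>, Y_\<alpha>} = {M. M$1$1 = 0 \<and> M$1$2 = 0 \<and> M$1$3 = 0 \<and> M$2$2 = 0
   \<and> M$3$1 = 0 \<and> M$3$2 = 0 \<and> M$3$3 = 0}"  (is "_ = ?R")
proof
  show "span {X_\<beta>, Y_\<alpha>} \<subseteq> ?R"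
    by (rule span_minimal) (auto simp: basis_defs subspace_def algebra_simps)
  show "?R \<subseteq> span {X_\<beta>, Y_\<alpha>}"
  proof
    fix M :: "real^3^3"
    assume "M \<in> ?R"
    then have "M = M$2$3 *\<^sub>R X_\<beta> + M$2$1 *\<^sub>R Y_\<alpha>"
      by (simp add: basis_defs matrix_3_eq_iff)
    then show "M \<in> span {X_\<beta>, Y_\<alpha>}"
      by (metis insertI1 insertI2 span_add span_base span_scale)
  qed
qed

lemma span_torus_eq: "span {H_\<alpha> - H_\<beta>} = {M. M$1$2 = 0 \<and> M$1$3 = 0 \<and> M$2$1 = 0 \<and> M$2$2 = - 2 * M$1$1
   \<and> M$2$3 = 0 \<and> M$3$1 = 0 \<and> M$3$2 = 0 \<and> M$3$3 = M$1$1}"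
  by (auto simp: span_singleton basis_defs matrix_3_eq_iff)

lemma span_columns_torus_eq: "span {X_\<alpha>, Y_\<beta>, H_\<alpha> - H_\<beta>} = {M. M$1$3 = 0 \<and> M$2$1 = 0
   \<and> M$2$2 = - 2 * M$1$1 \<and> M$2$3 = 0 \<and> M$3$1 = 0 \<and> M$3$3 = M$1$1}"  (is "_ = ?R")
proof
  show "span {X_\<alpha>, Y_\<beta>, H_\<alpha> - H_\<beta>} \<subseteq> ?R"
    by (rule span_minimal) (auto simp: basis_defs subspace_def algebra_simps)
  show "?R \<subseteq> span {X_\<alpha>, Y_\<beta>, H_\<alpha> - H_\<beta>}"
  proof
    fix M :: "real^3^3"
    assume "M \<in> ?R"
    then have "M = M$1$2 *\<^sub>R X_\<alpha> + M$3$2 *\<^sub>R Y_\<beta> + M$1$1 *\<^sub>R (H_\<alpha> - H_\<beta>)"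
      by (simp add: basis_defs matrix_3_eq_iff)
    then show "M \<in> span {X_\<alpha>, Y_\<beta>, H_\<alpha> - H_\<beta>}"
      by (metis insertI1 insertI2 span_add span_base span_scale)
  qed
qed

lemma span_rows_torus_eq: "span {X_\<beta>, Y_\<alpha>, H_\<alpha> - H_\<beta>} = {M. M$1$2 = 0 \<and> M$1$3 = 0
   \<and> M$2$2 = - 2 * M$1$1 \<and> M$3$1 = 0 \<and> M$3$2 = 0 \<and> M$3$3 = M$1$1}"  (is "_ = ?R")
proof
  show "span {X_\<beta>, Y_\<alpha>, H_\<alpha> - H_\<beta>} \<subseteq> ?R"
    by (rule span_minimal) (auto simp: basis_defs subspace_def algebra_simps)
  show "?R \<subseteq> span {X_\<beta>, Y_\<alpha>, H_\<alpha> - H_\<beta>}"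
  proof
    fix M :: "real^3^3"
    assume "M \<in> ?R"
    then have "M = M$2$3 *\<^sub>R X_\<beta> + M$2$1 *\<^sub>R Y_\<alpha> + M$1$1 *\<^sub>R (H_\<alpha> - H_\<beta>)"
      by (simp add: basis_defs matrix_3_eq_iff)
    then show "M \<in> span {X_\<beta>, Y_\<alpha>, H_\<alpha> - H_\<beta>}"
      by (metis insertI1 insertI2 span_add span_base span_scale)
  qed
qed

lemma set_plus_eq_by_projection:
  fixes S T W :: "'a::real_vector set"
  assumes "subspace W" "S \<subseteq> W" "T \<subseteq> W" "\<And>M. M \<in> W \<Longrightarrow> f M \<in> S \<and> M - f M \<in> T"
  shows "S + T = W"
proof
  show "S + T \<subseteq> W"
    using assms(1-3) by (auto simp: set_plus_def subspace_add subset_iff)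
  show "W \<subseteq> S + T"
  proof
    fix M assume "M \<in> W"
    then have "f M + (M - f M) \<in> S + T"
      using assms(4) by (intro set_plus_intro) auto
    then show "M \<in> S + T"
      by simp
  qed
qed

text \<open>The component in \<ss> for all five decompositions: the block on the indices 1 and 3,
  made traceless by removing half its trace from each diagonal entry.\<close>

definition sl2_part :: "real^3^3 \<Rightarrow> real^3^3" where
  "sl2_part M = (\<chi> i j. if i = 2 \<or> j = 2 then 0 else if i = j then M$i$j - (M$1$1 + M$3$3) / 2 else M$i$j)"

text \<open>In these five forms the last equation is tracelessness. Geometrically
  \<open>u_6_2\<close> stabilizes the line through the second basis vector, \<open>u_6_1\<close> the
  plane of the other two, and \<open>u_4_9\<close> both; \<open>u_5_2\<close> and
  \<open>u_5_3\<close> also kill the middle entry.\<close>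

lemma u_4_9_eq: "u_4_9 = {M. M$1$2 = 0 \<and> M$3$2 = 0 \<and> M$2$1 = 0 \<and> M$2$3 = 0 \<and> M$3$3 = - M$1$1 - M$2$2}"
  unfolding u_4_9_def \<ss>_eq span_torus_eq
  by (rule set_plus_eq_by_projection[where f = sl2_part])
     (auto simp: subspace_def sl2_part_def right_diff_distrib)

lemma u_5_2_eq: "u_5_2 = {M. M$2$1 = 0 \<and> M$2$3 = 0 \<and> M$2$2 = 0 \<and> M$3$3 = - M$1$1 - M$2$2}"
  unfolding u_5_2_def \<ss>_eq span_columns_eq
  by (rule set_plus_eq_by_projection[where f = sl2_part])
     (auto simp: subspace_def sl2_part_def right_diff_distrib)

lemma u_5_3_eq: "u_5_3 = {M. M$1$2 = 0 \<and> M$3$2 = 0 \<and> M$2$2 = 0 \<and> M$3$3 = - M$1$1 - M$2$2}"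
  unfolding u_5_3_def \<ss>_eq span_rows_eq
  by (rule set_plus_eq_by_projection[where f = sl2_part])
     (auto simp: subspace_def sl2_part_def right_diff_distrib)

lemma u_6_1_eq: "u_6_1 = {M. M$2$1 = 0 \<and> M$2$3 = 0 \<and> M$3$3 = - M$1$1 - M$2$2}"
  unfolding u_6_1_def \<ss>_eq span_columns_torus_eq
  by (rule set_plus_eq_by_projection[where f = sl2_part])
     (auto simp: subspace_def sl2_part_def right_diff_distrib)

lemma u_6_2_eq: "u_6_2 = {M. M$1$2 = 0 \<and> M$3$2 = 0 \<and> M$3$3 = - M$1$1 - M$2$2}"
  unfolding u_6_2_def \<ss>_eq span_rows_torus_eq
  by (rule set_plus_eq_by_projection[where f = sl2_part])
     (auto simp: subspace_def sl2_part_def right_diff_distrib)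

lemmas u_eqs = u_4_9_eq u_5_2_eq u_5_3_eq u_6_1_eq u_6_2_eq

lemma transpose_u:
  "transpose ` u_4_9 = u_4_9" "transpose ` u_5_3 = u_5_2" "transpose ` u_6_2 = u_6_1"
proof -
  \<comment> \<open>Transposition is an involution, so mapping each set into the other gives
    equality.\<close>
  have "transpose ` S = T" if "\<And>M. M \<in> S \<Longrightarrow> transpose M \<in> T" "\<And>M. M \<in> T \<Longrightarrow> transpose M \<in> S"
    for S T :: "(real^3^3) set"
    using that by (metis image_subsetI subsetI subset_antisym image_eqI transpose_transpose)
  from this[of u_4_9 u_4_9] this[of u_5_3 u_5_2] this[of u_6_2 u_6_1]
  show "transpose ` u_4_9 = u_4_9" "transpose ` u_5_3 = u_5_2" "transpose ` u_6_2 = u_6_1"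
    by (simp_all add: u_eqs) (simp_all add: transpose_def)
qed

lemma subspace_u: "subspace u_4_9" "subspace u_5_2" "subspace u_5_3" "subspace u_6_1" "subspace u_6_2"
  unfolding u_eqs by (auto simp: subspace_def right_diff_distrib)

lemma lie_subalgebra_u:
  "lie_subalgebra u_4_9" "lie_subalgebra u_5_2" "lie_subalgebra u_5_3" "lie_subalgebra u_6_1" "lie_subalgebra u_6_2"
  unfolding lie_subalgebra_def using subspace_u
  by (simp_all add: u_eqs lie_bracket_3_nth algebra_simps)

lemma lie_ideal_span_u:
  "lie_ideal (span {H_\<alpha> - H_\<beta>}) u_4_9" "lie_ideal \<ss> u_4_9"
  "lie_ideal (span {X_\<alpha>, Y_\<beta>}) u_5_2" "lie_ideal (span {X_\<beta>, Y_\<alpha>}) u_5_3"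
  "lie_ideal (span {X_\<alpha>, Y_\<beta>}) u_6_1" "lie_ideal (span {X_\<beta>, Y_\<alpha>}) u_6_2"
  "lie_ideal (span {X_\<alpha>, Y_\<beta>, H_\<alpha> - H_\<beta>}) u_6_1"
  "lie_ideal (span {X_\<beta>, Y_\<alpha>, H_\<alpha> - H_\<beta>}) u_6_2"
proof -
  have "subspace \<ss>"
    by (simp add: \<ss>_def)
  then show "lie_ideal (span {H_\<alpha> - H_\<beta>}) u_4_9" "lie_ideal \<ss> u_4_9"
    "lie_ideal (span {X_\<alpha>, Y_\<beta>}) u_5_2" "lie_ideal (span {X_\<beta>, Y_\<alpha>}) u_5_3"
    "lie_ideal (span {X_\<alpha>, Y_\<beta>}) u_6_1" "lie_ideal (span {X_\<beta>, Y_\<alpha>}) u_6_2"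
    "lie_ideal (span {X_\<alpha>, Y_\<beta>, H_\<alpha> - H_\<beta>}) u_6_1"
    "lie_ideal (span {X_\<beta>, Y_\<alpha>, H_\<alpha> - H_\<beta>}) u_6_2"
    unfolding lie_ideal_def
    by (simp_all only: subspace_span simp_thms)
       (auto simp: u_eqs \<ss>_eq span_torus_eq span_columns_eq span_rows_eq span_columns_torus_eq
          span_rows_torus_eq lie_bracket_3_nth trace_3 algebra_simps)
qed

lemma direct_sum_with_ideal_u:
  "direct_sum_with_ideal u_4_9 \<ss> (span {H_\<alpha> - H_\<beta>})"
  "direct_sum_with_ideal u_5_2 \<ss> (span {X_\<alpha>, Y_\<beta>})"
  "direct_sum_with_ideal u_5_3 \<ss> (span {X_\<beta>, Y_\<alpha>})"
  "direct_sum_with_ideal u_6_1 \<ss> (span {X_\<alpha>, Y_\<beta>, H_\<alpha> - H_\<beta>})"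
  "direct_sum_with_ideal u_6_2 \<ss> (span {X_\<beta>, Y_\<alpha>, H_\<alpha> - H_\<beta>})"
proof -
  have "subspace \<ss>"
    by (simp add: \<ss>_def)
  moreover have "\<ss> \<inter> span {H_\<alpha> - H_\<beta>} = {0}" "\<ss> \<inter> span {X_\<alpha>, Y_\<beta>} = {0}" "\<ss> \<inter> span {X_\<beta>, Y_\<alpha>} = {0}"
     "\<ss> \<inter> span {X_\<alpha>, Y_\<beta>, H_\<alpha> - H_\<beta>} = {0}" "\<ss> \<inter> span {X_\<beta>, Y_\<alpha>, H_\<alpha> - H_\<beta>} = {0}"
    by (auto simp: \<ss>_eq span_torus_eq span_columns_eq span_rows_eq span_columns_torus_eq
          span_rows_torus_eq matrix_3_eq_iff)
  ultimately show "direct_sum_with_ideal u_4_9 \<ss> (span {H_\<alpha> - H_\<beta>})"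
    "direct_sum_with_ideal u_5_2 \<ss> (span {X_\<alpha>, Y_\<beta>})"
    "direct_sum_with_ideal u_5_3 \<ss> (span {X_\<beta>, Y_\<alpha>})"
    "direct_sum_with_ideal u_6_1 \<ss> (span {X_\<alpha>, Y_\<beta>, H_\<alpha> - H_\<beta>})"
    "direct_sum_with_ideal u_6_2 \<ss> (span {X_\<beta>, Y_\<alpha>, H_\<alpha> - H_\<beta>})"
    using lie_ideal_span_u unfolding direct_sum_with_ideal_def
    by (simp_all add: u_4_9_def u_5_2_def u_5_3_def u_6_1_def u_6_2_def)
qed

section \<open>Dimensions of the five subalgebras\<close>

text \<open>A repeated entry would be orthogonal to itself and hence zero. So the list is distinct,
  and its entries are independent.\<close>

lemma dim_span_orthogonal_list:
  fixes xs :: "'a::euclidean_space list"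
  assumes "sorted_wrt orthogonal xs" "0 \<notin> set xs"
  shows "dim (span (set xs)) = length xs"
proof -
  have "pairwise orthogonal (set xs) \<and> distinct xs"
    using assms by (induction xs) (auto simp: pairwise_insert orthogonal_commute orthogonal_self)
  then show ?thesis
    using assms(2) by (simp add: dim_eq_card_independent pairwise_orthogonal_independent distinct_card)
qed

lemma inner_3: "A \<bullet> B = A$1$1 * B$1$1 + A$1$2 * B$1$2 + A$1$3 * B$1$3 + A$2$1 * B$2$1
  + A$2$2 * B$2$2 + A$2$3 * B$2$3 + A$3$1 * B$3$1 + A$3$2 * B$3$2 + A$3$3 * B$3$3"
  for A B :: "real^3^3"
  by (simp add: inner_vec_def sum_3)

lemma span_plus_span: "span S + span T = span (S \<union> T)"
  by (auto simp: span_Un set_plus_def)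

lemma u_span:
  "u_4_9 = span (set [X_\<alpha>\<beta>, Y_\<alpha>\<beta>, H_\<alpha> + H_\<beta>, H_\<alpha> - H_\<beta>])"
  "u_5_2 = span (set [X_\<alpha>\<beta>, Y_\<alpha>\<beta>, H_\<alpha> + H_\<beta>, X_\<alpha>, Y_\<beta>])"
  "u_5_3 = span (set [X_\<alpha>\<beta>, Y_\<alpha>\<beta>, H_\<alpha> + H_\<beta>, X_\<beta>, Y_\<alpha>])"
  "u_6_1 = span (set [X_\<alpha>\<beta>, Y_\<alpha>\<beta>, H_\<alpha> + H_\<beta>, X_\<alpha>, Y_\<beta>, H_\<alpha> - H_\<beta>])"
  "u_6_2 = span (set [X_\<alpha>\<beta>, Y_\<alpha>\<beta>, H_\<alpha> + H_\<beta>, X_\<beta>, Y_\<alpha>, H_\<alpha> - H_\<beta>])"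
  by (simp_all add: u_4_9_def u_5_2_def u_5_3_def u_6_1_def u_6_2_def \<ss>_def span_plus_span insert_commute)

lemma dim_u: "dim u_4_9 = 4" "dim u_5_2 = 5" "dim u_5_3 = 5" "dim u_6_1 = 6" "dim u_6_2 = 6"
proof -
  \<comment> \<open>An orthogonal basis of \<open>sl\<close>: \<open>H_\<alpha> + H_\<beta>\<close>
    and \<open>H_\<alpha> - H_\<beta>\<close> are orthogonal, unlike \<open>H_\<alpha>\<close> and
    \<open>H_\<beta>\<close>. Each of the five algebras is spanned by a sublist.\<close>
  let ?B = "[X_\<alpha>\<beta>, Y_\<alpha>\<beta>, H_\<alpha> + H_\<beta>, X_\<alpha>, Y_\<beta>, X_\<beta>, Y_\<alpha>, H_\<alpha> - H_\<beta>]"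
  have nonzero: "0 \<notin> set ?B"
    by (simp add: matrix_3_eq_iff basis_defs)
  have orthogonal: "sorted_wrt orthogonal ?B"
    by (simp add: orthogonal_def inner_3 basis_defs)
  have sublists: "dim (span (set [a, b, c, h])) = 4" "dim (span (set [a, b, c, d, e])) = 5"
    "dim (span (set [a, b, c, f, g])) = 5" "dim (span (set [a, b, c, d, e, h])) = 6"
    "dim (span (set [a, b, c, f, g, h])) = 6"
    if "0 \<notin> set [a, b, c, d, e, f, g, h]" "sorted_wrt orthogonal [a, b, c, d, e, f, g, h]"
    for a b c d e f g h :: "real^3^3"
    using that dim_span_orthogonal_list[of "[a, b, c, h]"] dim_span_orthogonal_list[of "[a, b, c, d, e]"]
      dim_span_orthogonal_list[of "[a, b, c, f, g]"] dim_span_orthogonal_list[of "[a, b, c, d, e, h]"]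
      dim_span_orthogonal_list[of "[a, b, c, f, g, h]"]
    by auto
  show "dim u_4_9 = 4" "dim u_5_2 = 5" "dim u_5_3 = 5" "dim u_6_1 = 6" "dim u_6_2 = 6"
    unfolding u_span by (rule sublists[OF nonzero orthogonal])+
qed

section \<open>The five subalgebras are Levi decomposable\<close>

text \<open>The three generators form an \<open>sl\<^sub>2\<close>-triple, whose brackets return
  each generator up to a factor 1 or 2.\<close>

lemma \<ss>_perfect: "\<ss> \<subseteq> derived_algebra \<ss>"
proof -
  have "X_\<alpha>\<beta> \<in> \<ss>" "Y_\<alpha>\<beta> \<in> \<ss>" "H_\<alpha> + H_\<beta> \<in> \<ss>"
    by (auto simp: \<ss>_def span_base)
  then have "lie_bracket (H_\<alpha> + H_\<beta>) X_\<alpha>\<beta> \<in> derived_algebra \<ss>" "lie_bracket Y_\<alpha>\<beta> (H_\<alpha> + H_\<beta>) \<in> derived_algebra \<ss>"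
    "lie_bracket X_\<alpha>\<beta> Y_\<alpha>\<beta> \<in> derived_algebra \<ss>"
    by (auto intro: lie_bracket_in_derived_algebra)
  moreover have "lie_bracket (H_\<alpha> + H_\<beta>) X_\<alpha>\<beta> = 2 *\<^sub>R X_\<alpha>\<beta>"
    "lie_bracket Y_\<alpha>\<beta> (H_\<alpha> + H_\<beta>) = 2 *\<^sub>R Y_\<alpha>\<beta>" "lie_bracket X_\<alpha>\<beta> Y_\<alpha>\<beta> = H_\<alpha> + H_\<beta>"
    by (simp_all add: matrix_3_eq_iff lie_bracket_3_nth basis_defs)
  moreover have "X \<in> derived_algebra \<ss>" if "2 *\<^sub>R X \<in> derived_algebra \<ss>" for X
    using subspace_scale[OF subspace_derived_algebra that, of "1 / 2"] by simp
  ultimately have "X_\<alpha>\<beta> \<in> derived_algebra \<ss>" "Y_\<alpha>\<beta> \<in> derived_algebra \<ss>" "H_\<alpha> + H_\<beta> \<in> derived_algebra \<ss>"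
    by simp_all
  then show ?thesis
    using span_minimal[OF _ subspace_derived_algebra, of "{X_\<alpha>\<beta>, Y_\<alpha>\<beta>, H_\<alpha> + H_\<beta>}" \<ss>]
    by (simp flip: \<ss>_def)
qed

text \<open>Being perfect, \<ss> survives in every term of the derived series.\<close>

lemma not_lie_solvable_if_\<ss>_subset:
  assumes "\<ss> \<subseteq> U"
  shows "\<not> lie_solvable U"
proof
  assume "lie_solvable U"
  then obtain k where k: "(derived_algebra ^^ k) U = {0}"
    by (auto simp: lie_solvable_def)
  have "\<ss> \<subseteq> (derived_algebra ^^ k) U" for k
  proof (induction k)
    case (Suc k)
    then show ?case
      using derived_algebra_mono[OF Suc] \<ss>_perfect by simp
  qed (use assms in simp)
  with k have "X_\<alpha>\<beta> = 0"
    unfolding \<ss>_def by (metis insertI1 singletonD span_base subsetD)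
  then show False
    by (simp add: matrix_3_eq_iff basis_defs)
qed

lemma not_lie_semisimple:
  assumes "lie_ideal I U" "X \<in> I" "X \<noteq> 0" "\<And>A B. A \<in> I \<Longrightarrow> B \<in> I \<Longrightarrow> lie_bracket A B = 0"
  shows "\<not> lie_semisimple U"
proof -
  have "(derived_algebra ^^ 1) I = {0}"
    using derived_algebra_abelian[of I] assms(4) by simp
  then have "lie_solvable I"
    unfolding lie_solvable_def by blast
  then have "X \<in> solvable_radical U"
    using assms(1,2) unfolding solvable_radical_def by (auto intro: span_base)
  then show ?thesis
    using assms(3) by (auto simp: lie_semisimple_def)
qed

lemma levi_decomposable_u:
  assumes "U \<in> set levi_list"
  shows "U \<subseteq> sl" "lie_subalgebra U" "levi_decomposable U"
proof -
  show "U \<subseteq> sl" "lie_subalgebra U"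
    using assms lie_subalgebra_u by (auto simp: levi_list_def sl_def u_eqs trace_3)
  have "\<ss> \<subseteq> U"
    using assms by (auto simp: levi_list_def u_eqs \<ss>_eq trace_3)
  \<comment> \<open>The abelian ideals are the center of \<open>u_4_9\<close> and the
    two-dimensional column or row ideals of the others. The radicals of \<open>u_6_1\<close> and
    \<open>u_6_2\<close> are not abelian, hence the smaller ideals there.\<close>
  moreover have "\<not> lie_semisimple U"
  proof -
    have "\<not> lie_semisimple u_4_9"
      by (rule not_lie_semisimple[OF lie_ideal_span_u(1), of "H_\<alpha> - H_\<beta>"])
         (unfold span_torus_eq, auto simp: lie_bracket_3_nth basis_defs matrix_3_eq_iff)
    moreover have "\<not> lie_semisimple u_5_2"
      by (rule not_lie_semisimple[OF lie_ideal_span_u(3), of X_\<alpha>])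
         (unfold span_columns_eq, auto simp: lie_bracket_3_nth basis_defs matrix_3_eq_iff)
    moreover have "\<not> lie_semisimple u_5_3"
      by (rule not_lie_semisimple[OF lie_ideal_span_u(4), of X_\<beta>])
         (unfold span_rows_eq, auto simp: lie_bracket_3_nth basis_defs matrix_3_eq_iff)
    moreover have "\<not> lie_semisimple u_6_1"
      by (rule not_lie_semisimple[OF lie_ideal_span_u(5), of X_\<alpha>])
         (unfold span_columns_eq, auto simp: lie_bracket_3_nth basis_defs matrix_3_eq_iff)
    moreover have "\<not> lie_semisimple u_6_2"
      by (rule not_lie_semisimple[OF lie_ideal_span_u(6), of X_\<beta>])
         (unfold span_rows_eq, auto simp: lie_bracket_3_nth basis_defs matrix_3_eq_iff)
    ultimately show ?thesis
      using assms by (auto simp: levi_list_def)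
  qed
  ultimately show "levi_decomposable U"
    by (simp add: levi_decomposable_def not_lie_solvable_if_\<ss>_subset)
qed

section \<open>Invariant lines\<close>

text \<open>Serves twice: it separates the transposed pairs of equal dimension, and it starts the
  classification.\<close>

definition stabilizes_line :: "(real^'n^'n) set \<Rightarrow> bool" where
  "stabilizes_line U \<longleftrightarrow> (\<exists>v. v \<noteq> 0 \<and> (\<forall>M\<in>U. \<exists>c. M *v v = c *\<^sub>R v))"

lemma stabilizes_line_SL_conjugate:
  assumes "SL_conjugate U V" "stabilizes_line U"
  shows "stabilizes_line V"
proof -
  obtain g v where g: "g \<in> SL" "V = conj_by g ` U" and v: "v \<noteq> 0" "\<forall>M\<in>U. \<exists>c. M *v v = c *\<^sub>R v"
    using assms unfolding SL_conjugate_iff stabilizes_line_def by blast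
  \<comment> \<open>The conjugate algebra stabilizes the line through \<open>g *v v\<close>.\<close>
  have "matrix_inv g *v (g *v v) = v"
    by (simp add: matrix_vector_mul_assoc SL_matrix_inv(2)[OF g(1)])
  then have "g *v v \<noteq> 0" "\<And>M. conj_by g M *v (g *v v) = g *v (M *v v)"
    using v(1) by (auto simp: conj_by_def simp flip: matrix_vector_mul_assoc)
  then show ?thesis
    unfolding stabilizes_line_def g(2) using v(2)
    by (metis (no_types, lifting) imageE matrix_vector_mult_scaleR)
qed

lemma stabilizes_line_u: "stabilizes_line u_5_3" "stabilizes_line u_6_2"
proof -
  have "stabilizes_line U" if "U \<subseteq> u_6_2" for U
    unfolding stabilizes_line_def
  proof (intro exI conjI ballI)
    show "axis 2 1 \<noteq> (0::real^3)"
      by simp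
    show "M *v axis 2 1 = M$2$2 *\<^sub>R axis 2 1" if "M \<in> U" for M
      using that \<open>U \<subseteq> u_6_2\<close>
      by (auto simp: u_eqs vec_eq_iff forall_3 matrix_vector_mult_def sum_3 axis_def)
  qed
  moreover have "u_5_3 \<subseteq> u_6_2"
    by (auto simp: u_eqs)
  ultimately show "stabilizes_line u_5_3" "stabilizes_line u_6_2"
    by blast+
qed

lemma not_stabilizes_line_u: "\<not> stabilizes_line u_5_2" "\<not> stabilizes_line u_6_1"
proof -
  have "\<not> stabilizes_line U" if "u_5_2 \<subseteq> U" for U
  proof
    assume "stabilizes_line U"
    then obtain v where v: "v \<noteq> 0" "\<And>M. M \<in> U \<Longrightarrow> \<exists>c. M *v v = c *\<^sub>R v"
      by (auto simp: stabilizes_line_def)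
    have "\<exists>c. M *v v = c *\<^sub>R v" if "M \<in> u_5_2" for M
      using v that \<open>u_5_2 \<subseteq> U\<close> by auto
    \<comment> \<open>The first two matrices send \<open>v\<close> to its third entry times
      \<open>e\<^sub>1\<close> and its first entry times \<open>e\<^sub>3\<close>, which forces both
      entries to vanish. The third matrix then moves a multiple of \<open>e\<^sub>2\<close> off its
      line, so \<open>v = 0\<close>.\<close>
    from this[of "matrix_unit 1 3"] this[of "matrix_unit 3 1"] this[of "matrix_unit 1 2"] v(1)
    show False
      by (auto simp: u_eqs vec_eq_iff forall_3 trace_3 matrix_vector_mult_def sum_3)
  qed
  moreover have "u_5_2 \<subseteq> u_6_1"
    by (auto simp: u_eqs)
  ultimately show "\<not> stabilizes_line u_5_2" "\<not> stabilizes_line u_6_1"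
    by blast+
qed

text \<open>Dimension leaves only the pairs \<open>u_5_2\<close>, \<open>u_5_3\<close> and
  \<open>u_6_1\<close>, \<open>u_6_2\<close>, where exactly one member stabilizes a line.\<close>

lemma levi_list_not_conjugate:
  assumes "i < 5" "j < 5" "i \<noteq> j"
  shows "\<not> SL_conjugate (levi_list ! i) (levi_list ! j)"
proof
  assume conj: "SL_conjugate (levi_list ! i) (levi_list ! j)"
  have *: "i \<in> {0, 1, 2, 3, 4}" "j \<in> {0, 1, 2, 3, 4}"
    using assms by auto
  show False
    using * assms(3) SL_conjugate_dim[OF conj] stabilizes_line_SL_conjugate[OF conj] stabilizes_line_SL_conjugate[OF SL_conjugate_sym[OF conj]]
      stabilizes_line_u not_stabilizes_line_u
    by (elim insertE emptyE) (simp_all add: levi_list_def dim_u)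
qed

section \<open>Planes, eigenvectors and an invariant line or plane\<close>

lemma DIM_cart_real_3: "DIM(real^3) = 3"
  by simp

lemma subspace_dim_1:
  fixes S :: "'a::euclidean_space set"
  assumes "subspace S" "dim S = 1"
  obtains v where "v \<noteq> 0" "v \<in> S" "\<And>x. x \<in> S \<Longrightarrow> \<exists>c. x = c *\<^sub>R v"
proof -
  obtain B where B: "B \<subseteq> S" "independent B" "S \<subseteq> span B" "card B = dim S"
    using basis_exists by blast
  then obtain v where v: "B = {v}"
    using assms(2) card_1_singletonE by metis
  show thesis
  proof (rule that[of v])
    show "v \<noteq> 0"
      using B(2) v dependent_zero by blast
    show "v \<in> S"
      using B(1) v by blast
    show "\<exists>c. x = c *\<^sub>R v" if "x \<in> S" for x
      using B(3) that v by (auto simp: span_singleton)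
  qed
qed

text \<open>The orthogonal complement of \<open>S\<close> has dimension 3 - 2 = 1, and
  \<open>z\<close> spans it.\<close>

lemma plane_normal:
  fixes S :: "(real^3) set"
  assumes "subspace S" "dim S = 2"
  obtains z where "z \<noteq> 0" "\<And>y. y \<in> S \<Longrightarrow> orthogonal z y"
    "\<And>x. (\<And>y. y \<in> S \<Longrightarrow> orthogonal x y) \<Longrightarrow> \<exists>c. x = c *\<^sub>R z"
    "\<And>x. \<exists>y\<in>S. \<exists>c. x = y + c *\<^sub>R z"
proof -
  let ?T = "{y \<in> UNIV. \<forall>x\<in>S. orthogonal x y}"
  have "dim ?T + dim S = DIM(real^3)"
    using dim_subspace_orthogonal_to_vectors[OF assms(1) subspace_UNIV subset_UNIV] by simp
  then have "dim ?T = 1"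
    using assms(2) by simp
  moreover have "subspace ?T"
    by (auto simp: subspace_def orthogonal_def inner_add_right)
  ultimately obtain z where z: "z \<noteq> 0" "z \<in> ?T" "\<And>x. x \<in> ?T \<Longrightarrow> \<exists>c. x = c *\<^sub>R z"
    using subspace_dim_1 by blast
  show thesis
  proof (rule that[of z])
    show "z \<noteq> 0" by fact
    show "orthogonal z y" if "y \<in> S" for y
      using z(2) that by (simp add: orthogonal_commute)
    show line: "\<exists>c. x = c *\<^sub>R z" if "\<And>y. y \<in> S \<Longrightarrow> orthogonal x y" for x
      using that by (intro z(3)) (auto simp: orthogonal_commute)
    show "\<exists>y\<in>S. \<exists>c. x = y + c *\<^sub>R z" for x
    proof -
      obtain y w where yw: "x = y + w" "y \<in> span S" "\<And>u. u \<in> span S \<Longrightarrow> orthogonal w u"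
        using orthogonal_subspace_decomp_exists by metis
      then show ?thesis
        using line[of w] assms(1) by (metis span_eq_iff)
    qed
  qed
qed

text \<open>By Newton's identities the characteristic polynomial is \<open>t\<^sup>3\<close>.\<close>

lemma eigenvalue_zero_if_traces_zero:
  fixes A :: "real^3^3"
  assumes "trace A = 0" "trace (A ** A) = 0" "trace (A ** A ** A) = 0"
    and "A *v v = \<mu> *\<^sub>R v" "v \<noteq> 0"
  shows "\<mu> = 0"
proof -
  have "(A - mat \<mu>) *v v = 0"
    using assms(4) by (simp add: vec_eq_iff matrix_vector_mult_def mat_def forall_3 sum_3 algebra_simps)
  then have "\<not> invertible (A - mat \<mu>)"
    using assms(5) by (metis invertible_def matrix_left_invertible_ker)
  then have det: "det (A - mat \<mu>) = 0"
    by (simp add: invertible_det_nz)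
  have "6 * det (A - mat \<mu>) = trace A ^ 3 - 3 * trace A * trace (A ** A) + 2 * trace (A ** A ** A)
     - 3 * \<mu> * (trace A ^ 2 - trace (A ** A)) + 6 * \<mu>^2 * trace A - 6 * \<mu> ^ 3"
    unfolding det_3 trace_3 matrix_mult_3_nth by (simp add: mat_def) algebra
  then show ?thesis
    using det assms(1-3) by simp
qed

text \<open>The characteristic polynomial has odd degree, so the intermediate value theorem gives it
  a real root.\<close>

lemma real_eigenvector:
  fixes A :: "real^3^3"
  obtains \<mu> v where "v \<noteq> 0" "A *v v = \<mu> *\<^sub>R v"
proof -
  obtain a b c where det: "det (A - mat t) = - (t ^ 3) + a * t^2 + b * t + c" for t
  proof
    fix t
    show "det (A - mat t) = - (t ^ 3) + trace A * t^2
      + (A$1$2 * A$2$1 + A$1$3 * A$3$1 + A$2$3 * A$3$2 - A$1$1 * A$2$2 - A$1$1 * A$3$3 - A$2$2 * A$3$3) * t + det A"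
      by (simp add: det_3 trace_3 mat_def algebra_simps power2_eq_square power3_eq_cube)
  qed
  define f where "f t = - (t ^ 3) + a * t^2 + b * t + c" for t
  \<comment> \<open>Since \<open>K \<ge> 1\<close>, the lower terms at \<open>K\<close> and
    \<open>-K\<close> are at most
    \<open>(\<bar>a\<bar> + \<bar>b\<bar> + \<bar>c\<bar>) * K^2\<close>, which is below
    \<open>K^3\<close>; so the cubic term decides the signs there.\<close>
  define K where "K = 1 + \<bar>a\<bar> + \<bar>b\<bar> + \<bar>c\<bar>"
  have K: "K \<ge> 1"
    by (simp add: K_def)
  have bound: "\<bar>a * t^2 + b * t + c\<bar> \<le> K ^ 3" if "\<bar>t\<bar> = K" for t
  proof -
    have "t^2 = K^2"
      by (metis power2_abs that)
    then have "\<bar>a * t^2 + b * t + c\<bar> \<le> \<bar>a\<bar> * K^2 + \<bar>b\<bar> * K + \<bar>c\<bar>"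
      using that abs_triangle_ineq[of "a * t^2 + b * t" c] abs_triangle_ineq[of "a * t^2" "b * t"]
      by (simp add: abs_mult)
    also have "\<dots> \<le> \<bar>a\<bar> * K^2 + \<bar>b\<bar> * K^2 + \<bar>c\<bar> * K^2"
      using K self_le_power[OF K, of 2] one_le_power[OF K, of 2] mult_left_mono[of 1 "K^2" "\<bar>c\<bar>"]
      by (intro add_mono mult_left_mono) auto
    also have "\<dots> \<le> K * K^2"
      unfolding K_def distrib_right[symmetric] by (intro mult_right_mono) auto
    finally show ?thesis
      by (simp add: power3_eq_cube power2_eq_square mult.assoc)
  qed
  have "f K \<le> 0" "f (- K) \<ge> 0"
    using bound[of K] bound[of "- K"] K by (auto simp: f_def abs_le_iff)
  moreover have "continuous_on {- K..K} f"
    unfolding f_def by (intro continuous_intros)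
  ultimately obtain \<mu> where "f \<mu> = 0"
    using IVT2'[of f K 0 "- K"] K by auto
  then have "\<not> invertible (A - mat \<mu>)"
    using det by (simp add: invertible_det_nz f_def)
  then obtain v where "v \<noteq> 0" "(A - mat \<mu>) *v v = 0"
    by (metis invertible_left_inverse matrix_left_invertible_ker)
  then show thesis
    using that by (simp add: vec_eq_iff matrix_vector_mult_def mat_def forall_3 sum_3 algebra_simps)
qed

text \<open>A commutator \<open>C = [X, M]\<close> that commutes with \<open>X\<close> is nilpotent, as all its powers have trace zero.\<close>

lemma eigenvalue_zero_if_commutator:
  fixes X M :: "real^3^3"
  assumes "lie_bracket X (lie_bracket X M) = 0" "lie_bracket X M *v v = \<mu> *\<^sub>R v" "v \<noteq> 0"
  shows "\<mu> = 0"
proof -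
  define C where "C = lie_bracket X M"
  have comm: "X ** C = C ** X"
    using assms(1) by (simp add: C_def lie_bracket_def)
  \<comment> \<open>By cyclicity the trace of \<open>P [X, M]\<close> equals that of
    \<open>[P, X] M\<close>. This is applied to \<open>P = 1\<close>, \<open>C\<close> and
    \<open>C\<^sup>2\<close>, all of which commute with \<open>X\<close>.\<close>
  have trace: "trace (P ** C) = 0" if "X ** P = P ** X" for P
  proof -
    have "trace (P ** C) = trace (P ** X ** M) - trace (P ** M ** X)"
      by (simp add: C_def lie_bracket_def matrix_mult_linear_simps trace_sub matrix_mul_assoc)
    also have "trace (P ** M ** X) = trace (X ** P ** M)"
      by (metis trace_mul_sym matrix_mul_assoc)
    finally show ?thesis
      using that by simp
  qed
  show ?thesis
  proof (rule eigenvalue_zero_if_traces_zero[of C])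
    show "trace C = 0"
      using trace[of "mat 1"] by simp
    show "trace (C ** C) = 0" "trace (C ** C ** C) = 0"
      using comm by (auto intro!: trace) (metis matrix_mul_assoc)
  qed (use assms in \<open>simp_all add: C_def\<close>)
qed

text \<open>Ensures that eigenspaces and weight spaces of nonzero traceless matrices are
  proper.\<close>

lemma scalar_matrix_traceless:
  fixes A :: "real^3^3"
  assumes "trace A = 0" "\<And>v. A *v v = \<mu> *\<^sub>R v"
  shows "A = 0"
proof -
  have "A = mat \<mu>"
    using assms(2) by (auto simp: matrix_eq vec_eq_iff matrix_vector_mult_def mat_def forall_3 sum_3)
  then show ?thesis
    using assms(1) by (simp add: trace_3 mat_def vec_eq_iff)
qed

text \<open>A real eigenspace \<open>E\<close> of \<open>X\<close> is proper, nonzero and invariant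
  under every matrix commuting with \<open>X\<close>. If it is a line, it is the common eigenline.
  If it is a plane, the range of \<open>X - \<mu>\<close> is a line, and it is invariant for the
  same reason.\<close>

lemma common_eigenvector:
  fixes \<A> :: "(real^3^3) set"
  assumes "\<A> \<subseteq> sl" "X \<in> \<A>" "X \<noteq> 0" and comm: "\<And>X Y. X \<in> \<A> \<Longrightarrow> Y \<in> \<A> \<Longrightarrow> X ** Y = Y ** X"
  obtains v where "v \<noteq> 0" "\<And>Y. Y \<in> \<A> \<Longrightarrow> \<exists>c. Y *v v = c *\<^sub>R v"
proof -
  obtain \<mu> u where u: "u \<noteq> 0" "X *v u = \<mu> *\<^sub>R u"
    using real_eigenvector by blast
  define E where "E = {w. X *v w = \<mu> *\<^sub>R w}"
  have sub: "subspace E"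
    by (simp add: E_def subspace_def matrix_vector_right_distrib matrix_vector_mult_scaleR algebra_simps)
  have XY: "X *v (Y *v w) = Y *v (X *v w)" if "Y \<in> \<A>" for Y w
    using comm[OF assms(2) that] by (simp add: matrix_vector_mul_assoc)
  have inv: "Y *v w \<in> E" if "Y \<in> \<A>" "w \<in> E" for Y w
    using that by (simp add: E_def XY matrix_vector_mult_scaleR)
  have "trace X = 0"
    using assms(1,2) by (auto simp: sl_def)
  then have "E \<noteq> UNIV"
    using scalar_matrix_traceless[of X \<mu>] assms(3) by (auto simp: E_def)
  then have "dim E \<noteq> 3"
    using sub by (metis DIM_cart_real_3 dim_eq_full span_eq_iff)
  moreover have "dim E \<le> 3"
    using dim_subset_UNIV[of E] by simp
  moreover have "dim E \<noteq> 0"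
    using u by (auto simp: E_def)
  ultimately consider "dim E = 1" | "dim E = 2"
    by linarith
  then show thesis
  proof cases
    case 1
    then show thesis
      using subspace_dim_1[OF sub] inv that by metis
  next
    case 2
    obtain z where z: "\<And>x. \<exists>y\<in>E. \<exists>c. x = y + c *\<^sub>R z"
      using plane_normal[OF sub 2] by metis
    define N where "N w = X *v w - \<mu> *\<^sub>R w" for w
    have range: "\<exists>c. N w = c *\<^sub>R N z" for w
    proof -
      obtain y c where "y \<in> E" "w = y + c *\<^sub>R z"
        using z by blast
      then have "N w = c *\<^sub>R N z"
        by (simp add: N_def E_def matrix_vector_right_distrib matrix_vector_mult_scaleR algebra_simps)
      then show ?thesis ..
    qed
    have "N z \<noteq> 0"
    proof
      assume "N z = 0"
      then have "w \<in> E" for w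
        using range[of w] by (simp add: N_def E_def)
      then show False
        using \<open>E \<noteq> UNIV\<close> by auto
    qed
    moreover have "\<exists>c. Y *v N z = c *\<^sub>R N z" if "Y \<in> \<A>" for Y
    proof -
      have "Y *v N z = N (Y *v z)"
        by (simp add: N_def XY[OF that] matrix_vector_mult_diff_distrib matrix_vector_mult_scaleR)
      then show ?thesis
        using range by metis
    qed
    ultimately show thesis
      using that by blast
  qed
qed

text \<open>The transposes preserve the orthogonal complement of an invariant subspace, here the
  normal line of the plane \<open>W\<close>.\<close>

lemma transpose_image_stabilizes_line:
  fixes U :: "(real^3^3) set"
  assumes "subspace W" "dim W = 2" and inv: "\<And>M w. M \<in> U \<Longrightarrow> w \<in> W \<Longrightarrow> M *v w \<in> W"
  shows "stabilizes_line (transpose ` U)"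
proof -
  obtain z where z: "z \<noteq> 0" "\<And>y. y \<in> W \<Longrightarrow> orthogonal z y"
    "\<And>x. (\<And>y. y \<in> W \<Longrightarrow> orthogonal x y) \<Longrightarrow> \<exists>c. x = c *\<^sub>R z"
    using plane_normal[OF assms(1,2)] by metis
  have "\<exists>c. transpose M *v z = c *\<^sub>R z" if "M \<in> U" for M
  proof (rule z(3))
    fix y assume "y \<in> W"
    then have "orthogonal z (M *v y)"
      using z(2) inv that by blast
    then show "orthogonal (transpose M *v z) y"
      by (simp add: orthogonal_def dot_lmul_matrix)
  qed
  then show ?thesis
    unfolding stabilizes_line_def using z(1) by auto
qed

lemma levi_candidate_stabilizes_line:
  fixes U :: "(real^3^3) set"
  assumes "levi_candidate U"
  shows "stabilizes_line U \<or> stabilizes_line (transpose ` U)"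
proof -
  obtain \<A> where \<A>: "lie_ideal \<A> U" "\<A> \<noteq> {0}" and abelian: "\<And>X Y. X \<in> \<A> \<Longrightarrow> Y \<in> \<A> \<Longrightarrow> lie_bracket X Y = 0"
    using assms by (auto simp: levi_candidate_def has_abelian_ideal_def)
  have sub: "subspace \<A>" "\<A> \<subseteq> sl"
    using \<A>(1) assms by (auto simp: lie_ideal_def levi_candidate_def)
  obtain X0 where X0: "X0 \<in> \<A>" "X0 \<noteq> 0"
    using \<A>(2) subspace_0[OF sub(1)] by blast
  have comm: "X ** Y = Y ** X" if "X \<in> \<A>" "Y \<in> \<A>" for X Y
    using abelian[OF that] by (simp add: lie_bracket_def)
  obtain v where v: "v \<noteq> 0" "\<And>Y. Y \<in> \<A> \<Longrightarrow> \<exists>c. Y *v v = c *\<^sub>R v"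
    using common_eigenvector[OF sub(2) X0 comm] by metis
  \<comment> \<open>On \<A> the choice is unique, because \<open>v\<close> is nonzero.\<close>
  define weight where "weight Y = (SOME c. Y *v v = c *\<^sub>R v)" for Y
  have weight: "Y *v v = weight Y *\<^sub>R v" if "Y \<in> \<A>" for Y
    unfolding weight_def using someI_ex[OF v(2)[OF that]] .
  define W where "W = {w. \<forall>Y\<in>\<A>. Y *v w = weight Y *\<^sub>R w}"
  have W: "subspace W"
    by (simp add: W_def subspace_def matrix_vector_right_distrib matrix_vector_mult_scaleR algebra_simps)
  have inv: "M *v w \<in> W" if "M \<in> U" "w \<in> W" for M w
  proof -
    have "Y *v (M *v w) = weight Y *\<^sub>R (M *v w)" if "Y \<in> \<A>" for Y
    proof -
      \<comment> \<open>The commutator lies in the abelian ideal and so commutes with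
        \<open>Y\<close>; its eigenvalue on \<open>v\<close> is then 0. By definition of
        \<open>W\<close> it kills all of \<open>W\<close>, so \<open>Y\<close> and \<open>M\<close>
        commute there.\<close>
      have C: "lie_bracket Y M \<in> \<A>"
        using \<A>(1) \<open>M \<in> U\<close> that subspace_neg[OF sub(1)] lie_bracket_swap[of Y M]
        by (simp add: lie_ideal_def)
      then have "weight (lie_bracket Y M) = 0"
        using eigenvalue_zero_if_commutator[OF abelian[OF that C] weight[OF C] v(1)] by simp
      then have "lie_bracket Y M *v w = 0"
        using C \<open>w \<in> W\<close> by (simp add: W_def)
      then have "Y *v (M *v w) = M *v (Y *v w)"
        by (simp add: lie_bracket_def matrix_vector_mul_assoc matrix_vector_mult_diff_rdistrib)
      then show ?thesis
        using that \<open>w \<in> W\<close> by (simp add: W_def matrix_vector_mult_scaleR)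
    qed
    then show ?thesis
      by (simp add: W_def)
  qed
  have "v \<in> W"
    using weight by (simp add: W_def)
  have "trace X0 = 0"
    using sub(2) X0(1) by (auto simp: sl_def)
  then have "W \<noteq> UNIV"
    using scalar_matrix_traceless[of X0] X0 by (auto simp: W_def)
  then have "dim W \<noteq> 3"
    using W by (metis DIM_cart_real_3 dim_eq_full span_eq_iff)
  moreover have "dim W \<le> 3"
    using dim_subset_UNIV[of W] by simp
  moreover have "dim W \<noteq> 0"
    using v(1) \<open>v \<in> W\<close> by auto
  ultimately consider "dim W = 1" | "dim W = 2"
    by linarith
  then show ?thesis
  proof cases
    case 1
    obtain w where "w \<noteq> 0" "w \<in> W" "\<And>x. x \<in> W \<Longrightarrow> \<exists>c. x = c *\<^sub>R w"
      using subspace_dim_1[OF W 1] by metis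
    then show ?thesis
      unfolding stabilizes_line_def using inv by blast
  next
    case 2
    then show ?thesis
      using transpose_image_stabilizes_line[OF W 2 inv] by blast
  qed
qed

section \<open>Subalgebras of the stabilizer of a line\<close>

text \<open>On \<open>u_6_2\<close> this is the projection onto \<open>u_4_9\<close> along the ideal
  \<open>\<langle>X_\<beta>, Y_\<alpha>\<rangle>\<close>, and hence a homomorphism there.\<close>

definition block_part :: "real^3^3 \<Rightarrow> real^3^3" where
  "block_part M = (\<chi> i j. if i = 2 \<and> j \<noteq> 2 then 0 else M$i$j)"

lemma linear_block_part: "linear block_part"
  by (auto intro!: linearI simp: block_part_def vec_eq_iff)

lemma block_part_lie_bracket:
  "A \<in> u_6_2 \<Longrightarrow> B \<in> u_6_2 \<Longrightarrow> block_part (lie_bracket A B) = lie_bracket (block_part A) (block_part B)"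
  by (simp add: u_eqs block_part_def lie_bracket_3_nth matrix_3_eq_iff)

lemma block_part_eq_0:
  assumes "M \<in> u_6_2" "block_part M = 0"
  shows "M \<in> span {X_\<beta>, Y_\<alpha>}"
  using assms by (simp add: span_rows_eq u_eqs block_part_def matrix_3_eq_iff)

lemma lie_bracket_rows:
  "A \<in> span {X_\<beta>, Y_\<alpha>} \<Longrightarrow> B \<in> span {X_\<beta>, Y_\<alpha>} \<Longrightarrow> lie_bracket A B = 0"
  unfolding span_rows_eq by (simp add: lie_bracket_3_nth matrix_3_eq_iff)

lemma dim_\<ss>: "dim \<ss> = 3"
proof -
  have "dim (span (set [X_\<alpha>\<beta>, Y_\<alpha>\<beta>, H_\<alpha> + H_\<beta>])) = length [X_\<alpha>\<beta>, Y_\<alpha>\<beta>, H_\<alpha> + H_\<beta>]"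
    by (rule dim_span_orthogonal_list) (simp_all add: orthogonal_def inner_3 matrix_3_eq_iff basis_defs)
  then show ?thesis
    by (simp add: \<ss>_def)
qed

text \<open>If the traceless part of the block projection of \<open>U\<close> had dimension at most \<open>2\<close>, its second
  derived algebra would vanish; the rows that are left over commute.\<close>

lemma \<ss>_subset_block_part:
  assumes U: "lie_subalgebra U" "U \<subseteq> u_6_2" "\<not> lie_solvable U"
  shows "\<ss> \<subseteq> block_part ` U"
proof -
  let ?D = "derived_algebra U"
  have D: "lie_subalgebra ?D" "?D \<subseteq> U"
    using U(1) by (simp_all add: lie_subalgebra_derived_algebra derived_algebra_subset)
  have "?D \<subseteq> {M. block_part M \<in> \<ss>}"
  proof (rule derived_algebra_minimal)
    show "subspace {M. block_part M \<in> \<ss>}"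
      using linear_subspace_vimage[OF linear_block_part, of \<ss>] by (simp add: vimage_def \<ss>_def)
    \<comment> \<open>Brackets in the block algebra have zero middle entry and a traceless
      block.\<close>
    show "lie_bracket A B \<in> {M. block_part M \<in> \<ss>}" if "A \<in> U" "B \<in> U" for A B
      using subsetD[OF U(2) that(1)] subsetD[OF U(2) that(2)]
      by (simp add: u_eqs \<ss>_eq block_part_def lie_bracket_3_nth)
  qed
  then have sub: "block_part ` ?D \<subseteq> \<ss>"
    by blast
  have "\<not> dim (block_part ` ?D) \<le> 2"
  proof
    assume "dim (block_part ` ?D) \<le> 2"
    then have "(derived_algebra ^^ 2) (block_part ` ?D) = {0}"
      by (simp add: derived_algebra_twice_dim_le_2 numeral_2_eq_2)
    moreover have "(derived_algebra ^^ 2) (block_part ` ?D) = block_part ` (derived_algebra ^^ 2) ?D"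
      using D U(2) by (intro derived_series_image[where c = 1] linear_block_part)
        (auto simp: block_part_lie_bracket subset_iff)
    ultimately have block_0: "block_part M = 0" if "M \<in> (derived_algebra ^^ 2) ?D" for M
      using that by blast
    have rows: "(derived_algebra ^^ 2) ?D \<subseteq> span {X_\<beta>, Y_\<alpha>}"
    proof
      fix M assume M: "M \<in> (derived_algebra ^^ 2) ?D"
      then have "M \<in> u_6_2"
        using derived_series_subset(2)[OF D(1), of 2] D(2) U(2) by blast
      then show "M \<in> span {X_\<beta>, Y_\<alpha>}"
        using block_0[OF M] block_part_eq_0 by blast
    qed
    have "derived_algebra ((derived_algebra ^^ 2) ?D) = {0}"
      by (rule derived_algebra_abelian)
        (use rows lie_bracket_rows in blast)
    \<comment> \<open>4 = 1 + 2 + 1: one step to \<open>?D\<close>, two to kill the block part, one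
      for the commuting rows.\<close>
    then have "(derived_algebra ^^ 4) U = {0}"
      by (simp add: eval_nat_numeral)
    then show False
      using U(3) by (auto simp: lie_solvable_def)
  qed
  then have "block_part ` ?D = \<ss>"
    using sub D(1) dim_\<ss>
    by (intro subspace_dim_equal linear_subspace_image[OF linear_block_part])
       (auto simp: lie_subalgebra_def \<ss>_def)
  then show ?thesis
    using D(2) by blast
qed

text \<open>Irreducibility made explicit: lifts \<open>P\<close> and \<open>Q\<close> of
  \<open>E\<^sub>1\<^sub>3\<close> and \<open>E\<^sub>3\<^sub>1\<close> carry
  \<open>Y_\<alpha>\<close> to \<open>- X_\<beta>\<close> and \<open>X_\<beta>\<close> to
  \<open>- Y_\<alpha>\<close>, and each kills the other row vector. The unknown rows of the lifts do
  not affect these brackets, because rows commute.\<close>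

lemma rows_subset:
  assumes U: "lie_subalgebra U" "U \<subseteq> u_6_2" "\<ss> \<subseteq> block_part ` U"
    and R: "R \<in> U" "R \<in> span {X_\<beta>, Y_\<alpha>}" "R \<noteq> 0"
  shows "span {X_\<beta>, Y_\<alpha>} \<subseteq> U"
proof -
  have sub: "subspace U" and bracket: "\<And>A B. A \<in> U \<Longrightarrow> B \<in> U \<Longrightarrow> lie_bracket A B \<in> U"
    using U(1) by (auto simp: lie_subalgebra_def)
  have "- X_\<alpha>\<beta> \<in> block_part ` U" "- Y_\<alpha>\<beta> \<in> block_part ` U"
    using U(3) by (auto simp: \<ss>_eq basis_defs)
  then obtain P Q where P: "P \<in> U" "block_part P = - X_\<alpha>\<beta>" and Q: "Q \<in> U" "block_part Q = - Y_\<alpha>\<beta>"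
    by auto
  have *: "lie_bracket P S = (- S$2$1) *\<^sub>R X_\<beta>" "lie_bracket Q S = (- S$2$3) *\<^sub>R Y_\<alpha>"
    if "S \<in> span {X_\<beta>, Y_\<alpha>}" for S
    using that[unfolded span_rows_eq] P(2) Q(2)
    by (simp_all add: matrix_3_eq_iff lie_bracket_3_nth block_part_def basis_defs)
  have scale: "S \<in> U" if "c *\<^sub>R S \<in> U" "c \<noteq> 0" for c S
    using subspace_scale[OF sub that(1), of "inverse c"] that(2) by simp
  have "R$2$1 \<noteq> 0 \<or> R$2$3 \<noteq> 0"
    using R(2,3) by (auto simp: span_rows_eq matrix_3_eq_iff)
  then have "X_\<beta> \<in> U \<or> Y_\<alpha> \<in> U"
    using *[OF R(2)] bracket[OF P(1) R(1)] bracket[OF Q(1) R(1)] scale by (metis neg_equal_0_iff_equal)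
  moreover have "lie_bracket P Y_\<alpha> = (- 1) *\<^sub>R X_\<beta>" "lie_bracket Q X_\<beta> = (- 1) *\<^sub>R Y_\<alpha>"
    using *(1)[of Y_\<alpha>] *(2)[of X_\<beta>] by (simp_all add: span_base) (simp_all add: basis_defs)
  then have "Y_\<alpha> \<in> U \<longrightarrow> X_\<beta> \<in> U" "X_\<beta> \<in> U \<longrightarrow> Y_\<alpha> \<in> U"
    using bracket[OF P(1), of Y_\<alpha>] bracket[OF Q(1), of X_\<beta>] scale[of "- 1"] zero_neq_neg_one[symmetric]
    by metis+
  ultimately have "X_\<beta> \<in> U \<and> Y_\<alpha> \<in> U"
    by blast
  then show ?thesis
    using sub by (intro span_minimal) auto
qed

text \<open>Subtracting rows from lifts puts \<ss> itself into \<open>U\<close>, so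
  \<open>u_5_3\<close> lies in \<open>U\<close>. Inside \<open>u_6_2\<close> it is the kernel of the
  middle entry, a hyperplane, so nothing fits strictly between.\<close>

lemma rows_subset_cases:
  assumes U: "lie_subalgebra U" "U \<subseteq> u_6_2" "\<ss> \<subseteq> block_part ` U" and rows: "span {X_\<beta>, Y_\<alpha>} \<subseteq> U"
  shows "U = u_5_3 \<or> U = u_6_2"
proof -
  have sub: "subspace U"
    using U(1) by (simp add: lie_subalgebra_def)
  have "\<ss> \<subseteq> U"
  proof
    fix S assume "S \<in> \<ss>"
    then obtain M where M: "M \<in> U" "S = block_part M"
      using U(3) by auto
    then have "M - S \<in> span {X_\<beta>, Y_\<alpha>}"
      using U(2) by (auto simp: span_rows_eq block_part_def u_eqs)
    then show "S \<in> U"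
      using subspace_diff[OF sub M(1), of "M - S"] rows by auto
  qed
  then have u_5_3: "u_5_3 \<subseteq> U"
    using rows sub by (auto simp: u_5_3_def set_plus_def subset_iff subspace_add)
  show ?thesis
  proof (cases "\<forall>M\<in>U. M$2$2 = 0")
    case True
    then have "U \<subseteq> u_5_3"
      using U(2) by (auto simp: u_eqs)
    then show ?thesis
      using u_5_3 by blast
  next
    case False
    then obtain M where M: "M \<in> U" "M$2$2 \<noteq> 0"
      by blast
    have "N \<in> U" if "N \<in> u_6_2" for N
    proof -
      let ?c = "N$2$2 / M$2$2"
      have "N - ?c *\<^sub>R M \<in> u_6_2"
        using that M(1) U(2) subspace_u(5) by (auto intro!: subspace_diff subspace_scale)
      then have "N - ?c *\<^sub>R M \<in> u_5_3"
        using M(2) by (simp add: u_eqs)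
      then show ?thesis
        using u_5_3 subspace_add[OF sub _ subspace_scale[OF sub M(1)], of "N - ?c *\<^sub>R M" ?c] by auto
    qed
    then show ?thesis
      using U(2) by blast
  qed
qed

text \<open>Elements of an abelian ideal satisfy the hypothesis, which says that
  \<open>(ad x)\<^sup>2\<close> vanishes on \<ss>. In \<open>sl\<^sub>2\<close> this fails for every
  nonzero \<open>x\<close>, even a nilpotent one, as the three basis elements \<open>m\<close>
  reveal.\<close>

lemma sl2_abelian_ideal_zero:
  assumes "x \<in> \<ss>" "\<And>m. m \<in> \<ss> \<Longrightarrow> lie_bracket x (lie_bracket m x) = 0"
  shows "x = 0"
proof -
  have "X_\<alpha>\<beta> \<in> \<ss>" "Y_\<alpha>\<beta> \<in> \<ss>" "H_\<alpha> + H_\<beta> \<in> \<ss>"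
    by (auto simp: \<ss>_def span_base)
  from assms(2)[OF this(1)] assms(2)[OF this(2)] assms(2)[OF this(3)] assms(1)
  show ?thesis
    by (simp add: \<ss>_eq matrix_3_eq_iff lie_bracket_3_nth basis_defs)
qed

text \<open>The unipotent \<open>1 - N/3\<close> conjugates \<open>D + N\<close> to \<open>D = H_\<alpha> - H_\<beta>\<close>, because \<open>[N, D] = 3 N\<close> and
  \<open>N\<^sup>2 = 0\<close>.\<close>

lemma unipotent_row:
  assumes "N \<in> span {X_\<beta>, Y_\<alpha>}"
  defines "g \<equiv> mat 1 - (1 / 3) *\<^sub>R N"
  shows "g \<in> SL" and "conj_by g ((H_\<alpha> - H_\<beta>) + N) = H_\<alpha> - H_\<beta>"
    and "\<And>M. M \<in> u_6_2 \<Longrightarrow> conj_by g M \<in> u_6_2"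
    and "\<And>M. M \<in> u_6_2 \<Longrightarrow> block_part (conj_by g M) = block_part M"
proof -
  have nth: "g$1$1 = 1" "g$1$2 = 0" "g$1$3 = 0" "g$2$1 = - N$2$1 / 3" "g$2$2 = 1" "g$2$3 = - N$2$3 / 3"
    "g$3$1 = 0" "g$3$2 = 0" "g$3$3 = 1"
    using assms(1) by (simp_all add: g_def mat_def span_rows_eq)
  show g: "g \<in> SL"
    by (simp add: SL_def det_3 nth)
  have inv: "matrix_inv g = mat 1 + (1 / 3) *\<^sub>R N"
    using assms(1) by (intro matrix_inv_unique) (simp add: matrix_3_eq_iff matrix_mult_3_nth nth mat_def span_rows_eq)
  show "conj_by g ((H_\<alpha> - H_\<beta>) + N) = H_\<alpha> - H_\<beta>"
    using assms(1)[unfolded span_rows_eq]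
    by (simp add: conj_by_def inv matrix_3_eq_iff matrix_mult_3_nth nth mat_def basis_defs)
  show "conj_by g M \<in> u_6_2" "block_part (conj_by g M) = block_part M" if "M \<in> u_6_2" for M
    using assms(1) that
    by (simp_all add: u_eqs conj_by_def inv matrix_3_eq_iff matrix_mult_3_nth nth mat_def span_rows_eq block_part_def)
qed

text \<open>Bracketing with \<open>H_\<alpha> - H_\<beta>\<close> extracts the row part of
  \<open>M\<close>, times -3. The result is a row in \<open>U\<close>, hence zero, so
  \<open>U\<close> has no row parts and equals its block projection.\<close>

lemma u_4_9_if_torus:
  assumes U: "lie_subalgebra U" "U \<subseteq> u_6_2" "\<ss> \<subseteq> block_part ` U" and D: "H_\<alpha> - H_\<beta> \<in> U"
    and rows: "U \<inter> span {X_\<beta>, Y_\<alpha>} = {0}"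
  shows "U = u_4_9"
proof
  have sub: "subspace U"
    using U(1) by (simp add: lie_subalgebra_def)
  show 49: "U \<subseteq> u_4_9"
  proof
    fix M assume M: "M \<in> U"
    then have "M \<in> u_6_2"
      using U(2) by blast
    then have bracket: "lie_bracket (H_\<alpha> - H_\<beta>) M = (- 3 * M$2$3) *\<^sub>R X_\<beta> + (- 3 * M$2$1) *\<^sub>R Y_\<alpha>"
      by (simp add: u_eqs matrix_3_eq_iff lie_bracket_3_nth basis_defs)
    have "lie_bracket (H_\<alpha> - H_\<beta>) M \<in> U"
      using U(1) D M by (simp add: lie_subalgebra_def)
    moreover have "lie_bracket (H_\<alpha> - H_\<beta>) M \<in> span {X_\<beta>, Y_\<alpha>}"
      unfolding bracket by (intro span_add span_scale span_base) auto
    ultimately have "lie_bracket (H_\<alpha> - H_\<beta>) M = 0"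
      using rows by blast
    then show "M \<in> u_4_9"
      using \<open>M \<in> u_6_2\<close> unfolding bracket by (simp add: u_eqs matrix_3_eq_iff basis_defs)
  qed
  have "block_part M = M" if "M \<in> u_4_9" for M
    using that by (simp add: u_eqs matrix_3_eq_iff block_part_def)
  then have "block_part ` U = U"
    using 49 by (simp add: subset_iff)
  then show "u_4_9 \<subseteq> U"
    using U(3) D span_minimal[OF _ sub, of "{H_\<alpha> - H_\<beta>}"] sub
    by (auto simp: u_4_9_def set_plus_def subset_iff subspace_add)
qed

lemma line_stabilizer_classification:
  assumes cand: "levi_candidate U" and U: "U \<subseteq> u_6_2"
  shows "\<exists>V\<in>{u_4_9, u_5_3, u_6_2}. SL_conjugate U V"
proof -
  have alg: "lie_subalgebra U" and "\<not> lie_solvable U"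
    using cand by (auto simp: levi_candidate_def)
  then have block: "\<ss> \<subseteq> block_part ` U"
    using U by (intro \<ss>_subset_block_part)
  have sub: "subspace U"
    using alg by (simp add: lie_subalgebra_def)
  show ?thesis
  proof (cases "U \<inter> span {X_\<beta>, Y_\<alpha>} = {0}")
    case False
    then obtain R where "R \<in> U" "R \<in> span {X_\<beta>, Y_\<alpha>}" "R \<noteq> 0"
      using subspace_0[OF sub] span_0 by blast
    then have "U = u_5_3 \<or> U = u_6_2"
      using rows_subset_cases rows_subset alg U block by metis
    then show ?thesis
      using SL_conjugate_refl by blast
  next
    case rows: True
    have "\<exists>M\<in>U. M$2$2 \<noteq> 0"
    proof (rule ccontr)
      assume "\<not> (\<exists>M\<in>U. M$2$2 \<noteq> 0)"
      then have in_\<ss>: "block_part M \<in> \<ss>" if "M \<in> U" for M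
        using that U by (auto simp: \<ss>_eq u_eqs block_part_def)
      obtain A where A: "lie_ideal A U" "A \<noteq> {0}" "\<And>X Y. X \<in> A \<Longrightarrow> Y \<in> A \<Longrightarrow> lie_bracket X Y = 0"
        using cand by (auto simp: levi_candidate_def has_abelian_ideal_def)
      then obtain X where X: "X \<in> A" "X \<noteq> 0"
        using subspace_0[of A] by (auto simp: lie_ideal_def)
      then have "X \<in> U"
        using A(1) by (auto simp: lie_ideal_def)
      \<comment> \<open>The block image now lies in \<ss>, and an abelian ideal has no nonzero image
        there. So \<open>X\<close> would be a nonzero row in \<open>U\<close>.\<close>
      have "block_part X = 0"
      proof (rule sl2_abelian_ideal_zero)
        show "block_part X \<in> \<ss>"
          using in_\<ss> \<open>X \<in> U\<close> .
        fix m assume "m \<in> \<ss>"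
        then obtain M where M: "M \<in> U" "m = block_part M"
          using block by auto
        then have MX: "lie_bracket M X \<in> A" "lie_bracket M X \<in> U"
          using A(1) X(1) by (auto simp: lie_ideal_def)
        have "block_part (lie_bracket X (lie_bracket M X)) = lie_bracket (block_part X) (lie_bracket m (block_part X))"
          using U \<open>X \<in> U\<close> M MX(2) by (simp add: block_part_lie_bracket subset_iff)
        then show "lie_bracket (block_part X) (lie_bracket m (block_part X)) = 0"
          using A(3)[OF X(1) MX(1)] linear_0[OF linear_block_part] by simp
      qed
      then show False
        using block_part_eq_0[of X] \<open>X \<in> U\<close> U rows X(2) by blast
    qed
    then obtain M where M: "M \<in> U" "M$2$2 \<noteq> 0"
      by blast
    \<comment> \<open>Scales the middle entry to -2, that of \<open>H_\<alpha> - H_\<beta>\<close>;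
      the blocks then differ by an element of \<ss>, which the lift \<open>S\<close>
      removes.\<close>
    define c where "c = - 2 / M$2$2"
    have "c *\<^sub>R M \<in> U"
      using sub M(1) by (simp add: subspace_scale)
    have "c * M$2$2 = - 2"
      using M(2) by (simp add: c_def)
    then have "block_part (c *\<^sub>R M) - (H_\<alpha> - H_\<beta>) \<in> \<ss>"
      using M U by (auto simp: \<ss>_eq block_part_def basis_defs u_eqs right_diff_distrib)
    then obtain S where S: "S \<in> U" "block_part S = block_part (c *\<^sub>R M) - (H_\<alpha> - H_\<beta>)"
      using block by auto
    define Z where "Z = c *\<^sub>R M - S"
    have Z: "Z \<in> U" "block_part Z = H_\<alpha> - H_\<beta>"
      using sub S \<open>c *\<^sub>R M \<in> U\<close>
      by (simp_all add: Z_def subspace_diff linear_diff[OF linear_block_part])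
    define N where "N = Z - (H_\<alpha> - H_\<beta>)"
    have N: "N \<in> span {X_\<beta>, Y_\<alpha>}"
    proof (rule block_part_eq_0)
      have D: "H_\<alpha> - H_\<beta> \<in> u_6_2" "block_part (H_\<alpha> - H_\<beta>) = H_\<alpha> - H_\<beta>"
        by (simp_all add: u_eqs block_part_def matrix_3_eq_iff basis_defs)
      show "N \<in> u_6_2"
        unfolding N_def using subsetD[OF U Z(1)] D(1) by (rule subspace_diff[OF subspace_u(5)])
      show "block_part N = 0"
        by (simp only: N_def linear_diff[OF linear_block_part, of Z] Z(2) D(2) diff_self)
    qed
    define g where "g = mat 1 - (1 / 3) *\<^sub>R N"
    note g = unipotent_row[OF N, folded g_def]
    have "conj_by g ` U = u_4_9"
    proof (rule u_4_9_if_torus)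
      show "lie_subalgebra (conj_by g ` U)"
        using alg by (intro lie_subalgebra_image[where c = 1] linear_conj_by)
          (simp_all add: conj_by_lie_bracket g(1))
      show "conj_by g ` U \<subseteq> u_6_2"
        using U g(3) by blast
      have "block_part ` conj_by g ` U = block_part ` U"
        unfolding image_image using U g(4) by (intro image_cong) auto
      then show "\<ss> \<subseteq> block_part ` conj_by g ` U"
        using block by simp
      show "H_\<alpha> - H_\<beta> \<in> conj_by g ` U"
        using g(2) Z(1) by (force simp: N_def)
      have zero: "conj_by g 0 = 0"
        by (rule linear_0[OF linear_conj_by])
      \<comment> \<open>Conjugation by \<open>g\<close> keeps the block part, so \<open>M\<close> is
        itself a row in \<open>U\<close>.\<close>
      have "conj_by g M = 0" if M: "M \<in> U" "conj_by g M \<in> span {X_\<beta>, Y_\<alpha>}" for M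
      proof -
        have "M \<in> u_6_2"
          using M(1) U by blast
        moreover have "block_part (conj_by g M) = 0"
          using M(2) by (simp add: span_rows_eq block_part_def matrix_3_eq_iff)
        ultimately have "M \<in> span {X_\<beta>, Y_\<alpha>}"
          using g(4)[of M] block_part_eq_0[of M] by simp
        then have "M = 0"
          using M(1) rows by blast
        then show ?thesis
          using zero by simp
      qed
      moreover have "0 \<in> conj_by g ` U"
        using zero subspace_0[OF sub] by (metis image_eqI)
      ultimately show "conj_by g ` U \<inter> span {X_\<beta>, Y_\<alpha>} = {0}"
        using span_0 by blast
    qed
    then show ?thesis
      unfolding SL_conjugate_iff using g(1) by blast
  qed
qed

section \<open>Assembling the classification\<close>

lemma stabilizes_line_classification:
  assumes "levi_candidate U" "stabilizes_line U"
  shows "\<exists>V\<in>{u_4_9, u_5_3, u_6_2}. SL_conjugate U V"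
proof -
  obtain v where v: "v \<noteq> 0" "\<And>M. M \<in> U \<Longrightarrow> \<exists>c. M *v v = c *\<^sub>R v"
    using assms(2) by (auto simp: stabilizes_line_def)
  \<comment> \<open>A rotation keeps the norm, which fixes the multiple of the second basis vector;
    its determinant 1 puts it in \<open>SL\<close>.\<close>
  obtain f where f: "orthogonal_transformation f" "det (matrix f) = 1" "f v = norm v *\<^sub>R axis 2 1"
    using rotation_exists[of v "norm v *\<^sub>R axis 2 1"] by (auto simp: norm_axis_1)
  define g where "g = matrix f"
  have g: "g \<in> SL"
    by (simp add: SL_def g_def f(2))
  have gv: "g *v v = norm v *\<^sub>R axis 2 1"
    using f(1,3) matrix_works[of f] by (simp add: g_def orthogonal_transformation_linear)
  have "conj_by g M \<in> u_6_2" if M: "M \<in> U" for M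
  proof -
    obtain c where c: "M *v v = c *\<^sub>R v"
      using v(2)[OF M] by blast
    have "conj_by g M *v (g *v v) = g *v (M *v ((matrix_inv g ** g) *v v))"
      by (simp only: conj_by_def matrix_vector_mul_assoc matrix_mul_assoc)
    then have "norm v *\<^sub>R (conj_by g M *v axis 2 1) = norm v *\<^sub>R (c *\<^sub>R axis 2 1)"
      by (simp add: SL_matrix_inv(2)[OF g] c matrix_vector_mult_scaleR gv)
    then have "conj_by g M *v axis 2 1 = c *\<^sub>R axis 2 1"
      using v(1) by (metis norm_eq_zero scaleR_cancel_left)
    then have "conj_by g M $1$2 = 0" "conj_by g M $3$2 = 0"
      by (simp_all add: vec_eq_iff forall_3 matrix_vector_mult_def sum_3 axis_def)
    moreover have "trace (conj_by g M) = 0"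
      using M assms(1) by (auto simp: trace_conj_by g levi_candidate_def sl_def)
    ultimately show ?thesis
      by (simp add: u_eqs trace_3)
  qed
  then obtain V where "V \<in> {u_4_9, u_5_3, u_6_2}" "SL_conjugate (conj_by g ` U) V"
    using line_stabilizer_classification[OF levi_candidate_conj_by[OF g assms(1)]] by blast
  moreover have "SL_conjugate U (conj_by g ` U)"
    using g by (auto simp: SL_conjugate_iff)
  ultimately show ?thesis
    using SL_conjugate_trans by blast
qed

lemma levi_candidate_classification:
  assumes "levi_candidate U"
  shows "\<exists>V\<in>set levi_list. SL_conjugate U V"
proof (cases "stabilizes_line U")
  case True
  then show ?thesis
    using stabilizes_line_classification[OF assms] by (auto simp: levi_list_def)
next
  case False
  then obtain V where V: "V \<in> {u_4_9, u_5_3, u_6_2}" "SL_conjugate (transpose ` U) V"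
    using levi_candidate_stabilizes_line[OF assms]
      stabilizes_line_classification[OF levi_candidate_transpose[OF assms]] by blast
  \<comment> \<open>Transposing back turns \<open>u_5_3\<close> and \<open>u_6_2\<close> into
    \<open>u_5_2\<close> and \<open>u_6_1\<close>, which supplies the rest of the list.\<close>
  then have "SL_conjugate U (transpose ` V)"
    using SL_conjugate_transpose[OF V(2)] by simp
  moreover have "transpose ` V \<in> set levi_list"
    using V(1) by (elim insertE emptyE) (simp_all add: levi_list_def transpose_u)
  ultimately show ?thesis
    by blast
qed

theorem theorem5p6:
  shows "lie_direct_sum u_4_9 \<ss> (span {H_\<alpha> - H_\<beta>})
    \<and> direct_sum_with_ideal u_5_2 \<ss> (span {X_\<alpha>, Y_\<beta>})
    \<and> direct_sum_with_ideal u_5_3 \<ss> (span {X_\<beta>, Y_\<alpha>})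
    \<and> direct_sum_with_ideal u_6_1 \<ss> (span {X_\<alpha>, Y_\<beta>, H_\<alpha> - H_\<beta>})
    \<and> direct_sum_with_ideal u_6_2 \<ss> (span {X_\<beta>, Y_\<alpha>, H_\<alpha> - H_\<beta>})
    \<and> dim u_4_9 = 4 \<and> dim u_5_2 = 5 \<and> dim u_5_3 = 5 \<and> dim u_6_1 = 6 \<and> dim u_6_2 = 6
    \<and> (\<forall>U\<in>set levi_list. U \<subseteq> sl \<and> lie_subalgebra U \<and> levi_decomposable U)
    \<and> (\<forall>U::(real^3^3) set. U \<subseteq> sl \<and> lie_subalgebra U \<and> levi_decomposable U
          \<longrightarrow> (\<exists>V\<in>set levi_list. SL_conjugate U V))
    \<and> (\<forall>i<5. \<forall>j<5. i \<noteq> j \<longrightarrow> \<not> SL_conjugate (levi_list ! i) (levi_list ! j))"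
proof (intro conjI allI ballI impI direct_sum_with_ideal_u dim_u)
  show "lie_direct_sum u_4_9 \<ss> (span {H_\<alpha> - H_\<beta>})"
    unfolding lie_direct_sum_def using direct_sum_with_ideal_u(1) lie_ideal_span_u(2) by blast
  show "\<exists>V\<in>set levi_list. SL_conjugate U V"
    if "U \<subseteq> sl \<and> lie_subalgebra U \<and> levi_decomposable U" for U :: "(real^3^3) set"
  proof (rule levi_candidate_classification)
    have "\<not> lie_semisimple U"
      using that by (simp add: levi_decomposable_def)
    then obtain A where "lie_ideal A U" "A \<noteq> {0}" "\<And>X Y. X \<in> A \<Longrightarrow> Y \<in> A \<Longrightarrow> lie_bracket X Y = 0"
      using abelian_ideal_exists by blast
    then have "has_abelian_ideal U"
      unfolding has_abelian_ideal_def by blast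
    then show "levi_candidate U"
      using that by (simp add: levi_candidate_def levi_decomposable_def)
  qed
qed (simp_all add: levi_decomposable_u levi_list_not_conjugate)

end
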